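(* Let $f:\mathbb{D}\to\mathbb{D}$ be holomorphic. Given $k\ge 1$, assume that $f$ is not a Blaschke product of degree at most $k$ and that there exists $z_0\in\mathbb{D}$ such that $f(z_0)=z_0$ and $f'(z_0)=\cdots=f^{(k-1)}(z_0)=0$ (the condition on derivatives being empty if $k=1$). Let $\sigma_1,\ldots,\sigma_n\in\partial\mathbb{D}$ be distinct points such that $\beta_f(\sigma_j)<+\infty$ and $$f(\sigma_j)=\frac{\left(\frac{\sigma_j-z_0}{1-\overline{z_0}\sigma_j}\right)^k+z_0}{1+\overline{z_0}\left(\frac{\sigma_j-z_0}{1-\overline{z_0}\sigma_j}\right)^k}$$ for $j=1,\ldots,n$. Then $$\sum_{j=1}^{n}\frac{1}{\left(1+2\operatorname{Re}\frac{\left(f(\sigma_j)-\sigma_j\right)\overline{z_0}}{|f(\sigma_j)-z_0|^2}\right)\beta_f(\sigma_j)-k}\le\frac{1-\left|\frac{f^{(k)}(z_0)}{k!}(1-|z_0|^2)^{k-1}\right|^2}{\left|1-\frac{f^{(k)}(z_0)}{k!}(1-|z_0|^2)^{k-1}\right|^2},$$ with equality if and only if $f$ is a Blaschke product of degree $n+k$.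
   Context: $\mathbb{D}=\{z\in\mathbb{C}:|z|<1\}$ and $\partial\mathbb{D}$ is the unit circle. For a holomorphic $f:\mathbb{D}\to\mathbb{D}$ and $\sigma\in\partial\mathbb{D}$, the boundary dilation coefficient is $\beta_f(\sigma)=\liminf_{z\to\sigma}\frac{1-|f(z)|}{1-|z|}$. If $\beta_f(\sigma)<+\infty$, then $f$ has a non-tangential limit at $\sigma$ (limit as $z\to\sigma$ inside each region $\{z\in\mathbb{D}:|\sigma-z|<M(1-|z|)\}$, $M>1$), lying in $\partial\mathbb{D}$ and denoted $f(\sigma)$. A Blaschke product of degree $d\ge 1$ is a function $B(z)=e^{i\theta}\prod_{j=1}^d\frac{z-a_j}{1-\overline{a_j}z}$ with $\theta\in\mathbb{R}$, $a_1,\ldots,a_d\in\mathbb{D}$; those of degree $0$ are the constants of modulus $1$. Here $n\ge1$. *)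

theory Defs
  imports "HOL-Complex_Analysis.Complex_Analysis"
begin

text \<open>
  The unit disc is \<^term>\<open>ball (0::complex) 1\<close>. Functions on the disc are total functions
  \<^typ>\<open>complex \<Rightarrow> complex\<close>; the notions below only depend on their values inside the disc.
\<close>

definition boundary_dilation :: "(complex \<Rightarrow> complex) \<Rightarrow> complex \<Rightarrow> ereal" where
  "boundary_dilation f \<sigma> =
     Liminf (at \<sigma> within ball 0 1) (\<lambda>z. ereal ((1 - norm (f z)) / (1 - norm z)))"

definition stolz_region :: "complex \<Rightarrow> real \<Rightarrow> complex set" where
  "stolz_region \<sigma> M = {z \<in> ball 0 1. norm (\<sigma> - z) < M * (1 - norm z)}"

definition has_nontangential_limit :: "(complex \<Rightarrow> complex) \<Rightarrow> complex \<Rightarrow> complex \<Rightarrow> bool" where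
  "has_nontangential_limit f \<sigma> l \<longleftrightarrow>
     (\<forall>M>1. (f \<longlongrightarrow> l) (at \<sigma> within stolz_region \<sigma> M))"

text \<open>
  The boundary value \<open>f(\<sigma>)\<close>. For \<open>\<bar>\<sigma>\<bar> = 1\<close> there is at most one non-tangential limit, because
  every region above contains the radius ending at \<open>\<sigma>\<close>. If the boundary dilation coefficient
  at \<open>\<sigma>\<close> of a holomorphic self-map of the disc is finite, the limit exists.
\<close>
definition boundary_value :: "(complex \<Rightarrow> complex) \<Rightarrow> complex \<Rightarrow> complex" where
  "boundary_value f \<sigma> = (THE l. has_nontangential_limit f \<sigma> l)"

text \<open>For \<open>d = 0\<close> the product is empty, which gives the unimodular constants.\<close>
definition blaschke_product :: "nat \<Rightarrow> (complex \<Rightarrow> complex) \<Rightarrow> bool" where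
  "blaschke_product d B \<longleftrightarrow>
     (\<exists>(\<theta>::real) (a :: nat \<Rightarrow> complex). (\<forall>j\<in>{1..d}. a j \<in> ball 0 1) \<and>
        (\<forall>z\<in>ball 0 1. B z = exp (\<i> * of_real \<theta>) * (\<Prod>j=1..d. (z - a j) / (1 - cnj (a j) * z))))"

end

theory Submission
  imports Defs "HOL-Computational_Algebra.Fundamental_Theorem_Algebra"
begin

text \<open>
  Conjugating by the disc automorphism \<open>T z = (z - z0) / (1 - cnj z0 * z)\<close> moves the fixed point to
  the origin, where the vanishing of the derivatives becomes a zero of order at least \<open>k\<close>: there is a
  holomorphic \<open>H\<close> on the disc with \<open>T (f z) = T z ^ k * H z\<close>, and \<open>H z0\<close> is the number \<open>c\<close> on the
  right-hand side. By the maximum principle \<open>H\<close> is bounded by 1, and it is a self-map of the disc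
  because otherwise it would be a unimodular constant, which makes \<open>f\<close> a Blaschke product of degree
  \<open>k\<close>. The prescribed value \<open>f(\<sigma>)\<close> says exactly that \<open>T (f(\<sigma>)) = T \<sigma> ^ k\<close>, that is, \<open>H\<close> has
  boundary value 1 at \<open>\<sigma>\<close>. Comparing how fast both sides approach the unit circle along the radius,
  the dilation coefficient of \<open>H\<close> at \<open>\<sigma>\<close> is that of \<open>T \<circ> f\<close> minus \<open>k\<close> times that of \<open>T\<close>; up to the
  factor \<open>(1 - |z0|\<^sup>2) / |\<sigma> - z0|\<^sup>2\<close>, which is the Poisson kernel of \<open>\<sigma>\<close> at \<open>z0\<close>, this is the
  denominator in the sum. So the theorem is the Cowen--Pommerenke inequality
  \<open>(\<Sum>j. P\<^sub>j z0 / b\<^sub>j) \<le> Re ((1 + H z0) / (1 - H z0))\<close> for a self-map \<open>H\<close> with boundary value 1 and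
  dilation coefficient \<open>b\<^sub>j\<close> at \<open>\<sigma>\<^sub>j\<close>, where \<open>P\<^sub>j\<close> is the Poisson kernel (lemma
  \<open>cowen_pommerenke\<close>).

  That inequality concerns the function \<open>F = (1 + H) / (1 - H)\<close>, whose real part is positive.
  In terms of the Herglotz measure of \<open>F\<close>, the point \<open>\<sigma>\<^sub>j\<close> carries mass \<open>1 / b\<^sub>j\<close>, and the masses of
  finitely many points add up to at most the total mass. Directly in terms of \<open>F\<close>, Julia's lemma
  gives \<open>Re F \<ge> P\<^sub>j / b\<^sub>j\<close> for each \<open>j\<close>. Kernels of different points can be subtracted one
  after the other (\<open>herglotz_atoms_add\<close>): subtracting those of other points does not change the
  radial growth at \<open>\<sigma>\<^sub>j\<close>, and a Harnack inequality turns radial growth of a nonnegative real part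
  back into a lower bound by the kernel.

  If equality holds at one point, the remainder is a holomorphic function whose nonnegative real part
  vanishes somewhere, hence an imaginary constant. So \<open>F\<close> is an imaginary constant plus a positive
  combination of Herglotz kernels, and clearing denominators exhibits \<open>H\<close> as a quotient \<open>p / q\<close> where
  \<open>q\<close> is, up to a unimodular factor, the conjugate reciprocal of \<open>p\<close> and has no zero in the closed
  disc. Such quotients are exactly the Blaschke products (\<open>blaschke_product_imp_rational\<close>,
  \<open>rational_imp_blaschke_product\<close>). Conversely, if \<open>H\<close> is a Blaschke product of degree \<open>n\<close>, then
  \<open>q - p\<close> has the \<open>n\<close> simple zeros \<open>\<sigma>\<^sub>j\<close>, a partial fraction expansion writes \<open>F\<close> as a constant plus a
  combination of the kernels, the radial behaviour at \<open>\<sigma>\<^sub>j\<close> identifies the coefficients as \<open>1 / b\<^sub>j\<close>,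
  and the constant is imaginary because \<open>F\<close> is imaginary on the circle. Finally, \<open>H\<close> is a Blaschke
  product of degree \<open>d\<close> iff \<open>f\<close> is one of degree \<open>d + k\<close>: the rational description is stable under
  disc automorphisms of the target, and factors of the product at \<open>z0\<close> can be split off.
\<close>

section \<open>Disc automorphisms and the Schwarz--Pick inequality\<close>

definition disc_aut :: "complex \<Rightarrow> complex \<Rightarrow> complex" where
  "disc_aut a z = (z - a) / (1 - cnj a * z)"

text \<open>
  The conformal map of the unit disc onto the right half-plane, with the boundary point 1 sent to
  infinity.
\<close>

definition cayley :: "complex \<Rightarrow> complex" where
  "cayley w = (1 + w) / (1 - w)"

text \<open>The Herglotz kernel, whose real part for \<open>\<bar>\<tau>\<bar> = 1\<close> is the Poisson kernel of \<open>\<tau>\<close>.\<close>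

definition herglotz :: "complex \<Rightarrow> complex \<Rightarrow> complex" where
  "herglotz \<tau> z = (\<tau> + z) / (\<tau> - z)"

lemma one_minus_cnj_mult_neq_0:
  assumes "norm a < 1" "norm z \<le> 1"
  shows "1 - cnj a * z \<noteq> 0"
proof
  assume "1 - cnj a * z = 0"
  then have "norm (cnj a * z) = 1" by simp
  moreover have "norm (cnj a * z) < 1"
    using assms mult_left_le[of "norm z" "norm a"] by (simp add: norm_mult)
  ultimately show False by simp
qed

lemma disc_identity:
  "(norm (1 - cnj a * z))\<^sup>2 - (norm (z - a))\<^sup>2 = (1 - (norm a)\<^sup>2) * (1 - (norm z)\<^sup>2)"
  unfolding cmod_power2 by (simp add: algebra_simps power2_eq_square)

lemma norm_unit_diff:
  assumes "norm \<tau> = 1"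
  shows "norm (1 - cnj \<tau> * z) = norm (\<tau> - z)"
proof -
  have "(norm (1 - cnj \<tau> * z))\<^sup>2 = (norm (z - \<tau>))\<^sup>2"
    using disc_identity[of \<tau> z] assms by simp
  then show ?thesis by (simp add: norm_minus_commute power2_eq_iff_nonneg)
qed

lemma one_minus_norm_disc_aut:
  assumes "norm a < 1" "norm z \<le> 1"
  shows "1 - (norm (disc_aut a z))\<^sup>2 =
           (1 - (norm a)\<^sup>2) * (1 - (norm z)\<^sup>2) / (norm (1 - cnj a * z))\<^sup>2"
  using disc_identity[of a z] one_minus_cnj_mult_neq_0[OF assms]
  by (simp add: disc_aut_def norm_divide power_divide field_simps)

lemma norm_disc_aut_less_1:
  assumes "norm a < 1" "norm z < 1"
  shows "norm (disc_aut a z) < 1"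
proof -
  have "1 - (norm (disc_aut a z))\<^sup>2 > 0"
    using assms one_minus_cnj_mult_neq_0[of a z]
    by (subst one_minus_norm_disc_aut) (auto simp: power_less_one_iff abs_square_less_1)
  then show ?thesis by (simp add: abs_square_less_1)
qed

lemma norm_disc_aut_eq_1:
  assumes "norm a < 1" "norm z = 1"
  shows "norm (disc_aut a z) = 1"
  using one_minus_norm_disc_aut[of a z] assms by (simp add: power2_eq_1_iff)
    (metis norm_ge_zero not_one_le_zero power2_eq_1_iff neg_0_le_iff_le)

lemma disc_aut_inverse:
  assumes "norm a < 1" "norm z \<le> 1"
  shows "disc_aut (- a) (disc_aut a z) = z"
proof -
  have 1: "1 - cnj a * z \<noteq> 0" by (rule one_minus_cnj_mult_neq_0[OF assms])
  have 2: "1 - cnj a * a \<noteq> 0" by (rule one_minus_cnj_mult_neq_0) (use assms in auto)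
  have "disc_aut a z + a = z * (1 - cnj a * a) / (1 - cnj a * z)"
    using 1 by (simp add: disc_aut_def field_simps)
  moreover have "1 + cnj a * disc_aut a z = (1 - cnj a * a) / (1 - cnj a * z)"
    using 1 by (simp add: disc_aut_def field_simps)
  ultimately show ?thesis
    using 1 2 by (simp add: disc_aut_def[of "- a"])
qed

lemma disc_aut_holomorphic:
  assumes "norm a < 1" "f holomorphic_on S" "\<And>z. z \<in> S \<Longrightarrow> norm (f z) \<le> 1"
  shows "(\<lambda>z. disc_aut a (f z)) holomorphic_on S"
  unfolding disc_aut_def
  using assms by (intro holomorphic_intros) (simp_all only: one_minus_cnj_mult_neq_0 not_False_eq_True)

lemma self_map_norm_less:
  "f ` ball 0 1 \<subseteq> ball 0 1 \<Longrightarrow> norm z < 1 \<Longrightarrow> norm (f z :: complex) < 1" for z :: complex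
  by (auto simp: image_subset_iff)

text \<open>
  Schwarz's lemma, applied after moving \<open>w\<close> and \<open>f w\<close> to the origin, bounds the pseudo-hyperbolic
  distance of \<open>f z\<close> and \<open>f w\<close>. The form without quotients has a meaningful limit as \<open>w\<close> tends to
  the circle.
\<close>

lemma schwarz_pick:
  assumes "f holomorphic_on ball 0 1" "f ` ball 0 1 \<subseteq> ball 0 1" "norm z < 1" "norm w < 1"
  shows "(norm (1 - cnj (f w) * f z))\<^sup>2 * ((1 - (norm z)\<^sup>2) * (1 - (norm w)\<^sup>2))
           \<le> (norm (1 - cnj w * z))\<^sup>2 * ((1 - (norm (f z))\<^sup>2) * (1 - (norm (f w))\<^sup>2))"
proof -
  have f1: "norm (f x) < 1" if "norm x < 1" for x
    using self_map_norm_less[OF assms(2) that] .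
  have w': "norm (- w) < 1" using assms by simp
  define g where "g = (\<lambda>x. disc_aut (f w) (f (disc_aut (- w) x)))"
  have holo: "(\<lambda>x. f (disc_aut (- w) x)) holomorphic_on ball 0 1"
  proof (rule holomorphic_on_compose_gen[OF _ assms(1), unfolded o_def])
    show "(\<lambda>x. disc_aut (- w) x) holomorphic_on ball 0 1"
      by (rule disc_aut_holomorphic[OF w']) (auto intro: holomorphic_on_ident)
    show "disc_aut (- w) ` ball 0 1 \<subseteq> ball 0 1"
      using norm_disc_aut_less_1[OF w'] by auto
  qed
  have "g holomorphic_on ball 0 1"
    unfolding g_def
    by (rule disc_aut_holomorphic[OF f1[OF assms(4)] holo])
       (simp add: less_imp_le[OF f1] norm_disc_aut_less_1[OF w'])
  moreover have "g 0 = 0"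
    by (simp add: g_def disc_aut_def)
  moreover have "norm (g x) < 1" if "norm x < 1" for x
    unfolding g_def by (intro norm_disc_aut_less_1 f1 that w' assms(4))
  ultimately have "norm (g (disc_aut w z)) \<le> norm (disc_aut w z)"
    by (rule Schwarz_Lemma(1)) (use assms norm_disc_aut_less_1 in auto)
  then have "norm (disc_aut (f w) (f z)) \<le> norm (disc_aut w z)"
    using assms by (simp add: g_def disc_aut_inverse)
  then have "1 - (norm (disc_aut w z))\<^sup>2 \<le> 1 - (norm (disc_aut (f w) (f z)))\<^sup>2"
    by (simp add: power_mono)
  then show ?thesis
    using assms f1 one_minus_cnj_mult_neq_0[of w z] one_minus_cnj_mult_neq_0[of "f w" "f z"]
    by (simp add: one_minus_norm_disc_aut less_imp_le field_simps)
qed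

section \<open>Julia's lemma and radial behaviour\<close>

text \<open>
  Julia's lemma is the limit of the Schwarz--Pick inequality as the second point tends to the
  boundary. The filter allows the approach to be along a sequence, on which a lower limit is attained,
  or along a radius.
\<close>

lemma julia:
  assumes holo: "f holomorphic_on ball 0 1" and maps: "f ` ball 0 1 \<subseteq> ball 0 1" and z: "norm z < 1"
    and G: "G \<noteq> bot" and ball: "eventually (\<lambda>x. norm (\<zeta> x) < 1) G"
    and lims: "(\<zeta> \<longlongrightarrow> \<sigma>) G" "((\<lambda>x. f (\<zeta> x)) \<longlongrightarrow> \<tau>) G"
    and u: "(u \<longlongrightarrow> b) G"
    and bound: "eventually (\<lambda>x. (1 - (norm (f (\<zeta> x)))\<^sup>2) / (1 - (norm (\<zeta> x))\<^sup>2) \<le> u x) G"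
  shows "(norm (1 - cnj \<tau> * f z))\<^sup>2 * (1 - (norm z)\<^sup>2)
           \<le> b * (norm (1 - cnj \<sigma> * z))\<^sup>2 * (1 - (norm (f z))\<^sup>2)"
proof (rule tendsto_le[OF G])
  show "((\<lambda>x. u x * (norm (1 - cnj (\<zeta> x) * z))\<^sup>2 * (1 - (norm (f z))\<^sup>2)) \<longlongrightarrow>
      b * (norm (1 - cnj \<sigma> * z))\<^sup>2 * (1 - (norm (f z))\<^sup>2)) G"
    by (intro tendsto_intros lims u)
  show "((\<lambda>x. (norm (1 - cnj (f (\<zeta> x)) * f z))\<^sup>2 * (1 - (norm z)\<^sup>2)) \<longlongrightarrow>
      (norm (1 - cnj \<tau> * f z))\<^sup>2 * (1 - (norm z)\<^sup>2)) G"
    by (intro tendsto_intros lims)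
  show "\<forall>\<^sub>F x in G. (norm (1 - cnj (f (\<zeta> x)) * f z))\<^sup>2 * (1 - (norm z)\<^sup>2) \<le>
      u x * (norm (1 - cnj (\<zeta> x) * z))\<^sup>2 * (1 - (norm (f z))\<^sup>2)"
    using ball bound
  proof eventually_elim
    case (elim x)
    let ?w = "\<zeta> x"
    have pos: "0 < 1 - (norm ?w)\<^sup>2" using elim by (simp add: abs_square_less_1)
    have fz: "norm (f z) < 1" using self_map_norm_less[OF maps z] .
    then have "0 \<le> 1 - (norm (f z))\<^sup>2" by (simp add: abs_square_le_1)
    then have *: "0 \<le> (norm (1 - cnj ?w * z))\<^sup>2 * (1 - (norm (f z))\<^sup>2)" by simp
    have "(norm (1 - cnj (f ?w) * f z))\<^sup>2 * (1 - (norm z)\<^sup>2) \<le>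
       (1 - (norm (f ?w))\<^sup>2) / (1 - (norm ?w)\<^sup>2) * ((norm (1 - cnj ?w * z))\<^sup>2 * (1 - (norm (f z))\<^sup>2))"
      using schwarz_pick[OF holo maps z elim(1)] pos by (simp add: field_simps)
    also have "\<dots> \<le> u x * ((norm (1 - cnj ?w * z))\<^sup>2 * (1 - (norm (f z))\<^sup>2))"
      by (rule mult_right_mono[OF elim(2) *])
    finally show ?case by (simp add: mult.assoc)
  qed
qed

lemma Re_cayley: "Re (cayley w) = (1 - (norm w)\<^sup>2) / (norm (1 - w))\<^sup>2"
  by (simp add: cayley_def Re_divide cmod_power2) (simp add: algebra_simps power2_eq_square)

lemma Re_herglotz:
  assumes "norm \<tau> = 1"
  shows "Re (herglotz \<tau> z) = (1 - (norm z)\<^sup>2) / (norm (\<tau> - z))\<^sup>2"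
proof -
  have "(Re \<tau>)\<^sup>2 + (Im \<tau>)\<^sup>2 = 1" using assms by (metis cmod_power2 one_power2)
  then show ?thesis
    unfolding herglotz_def Re_divide cmod_power2
    by (intro arg_cong2[where f = "(/)"]) (auto simp: algebra_simps power2_eq_square)
qed

lemma herglotz_holomorphic: "norm \<tau> = 1 \<Longrightarrow> herglotz \<tau> holomorphic_on ball 0 1"
  unfolding herglotz_def[abs_def] by (intro holomorphic_intros) auto

text \<open>
  The inequality is Schwarz--Pick for the self-map \<open>(F - 1) / (F + 1)\<close>, combined with
  \<open>(Re (F w))\<^sup>2 \<le> |F z + cnj (F w)|\<^sup>2\<close>. For \<open>w\<close> close to the circle, the constant 4 is the sharp one of
  Harnack's inequality: it compares \<open>Re F\<close> with the full Poisson kernel.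
\<close>

lemma harnack_pos:
  assumes "F holomorphic_on ball 0 1" "\<And>z. norm z < 1 \<Longrightarrow> 0 < Re (F z)" "norm z < 1" "norm w < 1"
  shows "Re (F w) * ((1 - (norm z)\<^sup>2) * (1 - (norm w)\<^sup>2)) \<le> 4 * (norm (1 - cnj w * z))\<^sup>2 * Re (F z)"
proof -
  define \<phi> where "\<phi> = (\<lambda>z. (F z - 1) / (F z + 1))"
  have nz: "F x + 1 \<noteq> 0" if "norm x < 1" for x
    using assms(2)[OF that] by (auto simp: complex_eq_iff)
  have holo: "\<phi> holomorphic_on ball 0 1"
    unfolding \<phi>_def using nz by (intro holomorphic_intros assms(1)) auto
  have id: "1 - (norm (\<phi> x))\<^sup>2 = 4 * Re (F x) / (norm (F x + 1))\<^sup>2" if "norm x < 1" for x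
  proof -
    have "(norm (F x + 1))\<^sup>2 - (norm (F x - 1))\<^sup>2 = 4 * Re (F x)"
      unfolding cmod_power2 by (simp add: power2_eq_square algebra_simps)
    moreover have "1 - (norm (\<phi> x))\<^sup>2 = ((norm (F x + 1))\<^sup>2 - (norm (F x - 1))\<^sup>2) / (norm (F x + 1))\<^sup>2"
    proof -
      have "norm (\<phi> x) = norm (F x - 1) / norm (F x + 1)"
        by (simp only: \<phi>_def norm_divide)
      then show ?thesis
        using nz[OF that] by (simp add: power_divide diff_divide_distrib)
    qed
    ultimately show ?thesis by simp
  qed
  have maps: "\<phi> ` ball 0 1 \<subseteq> ball 0 1"
  proof clarsimp
    fix x :: complex assume x: "norm x < 1"
    have "1 - (norm (\<phi> x))\<^sup>2 > 0"
      using assms(2)[OF x] nz[OF x] by (simp add: id[OF x])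
    then show "norm (\<phi> x) < 1" by (simp add: abs_square_less_1)
  qed
  have key: "1 - cnj (\<phi> w) * \<phi> z = 2 * (F z + cnj (F w)) / ((F z + 1) * cnj (F w + 1))"
  proof -
    have "cnj (F w) + 1 \<noteq> 0" using nz[OF assms(4)] by (metis complex_cnj_add complex_cnj_one complex_cnj_zero_iff)
    then have nz0: "(F z + 1) * cnj (F w + 1) \<noteq> 0" using nz[OF assms(3)] by simp
    have "cnj (\<phi> w) * \<phi> z = ((F z - 1) * cnj (F w - 1)) / ((F z + 1) * cnj (F w + 1))"
      by (simp add: \<phi>_def mult.commute)
    then have "1 - cnj (\<phi> w) * \<phi> z =
        ((F z + 1) * cnj (F w + 1) - (F z - 1) * cnj (F w - 1)) / ((F z + 1) * cnj (F w + 1))"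
      by (simp only: diff_divide_distrib divide_self[OF nz0])
    then show ?thesis by (simp add: algebra_simps)
  qed
  have P: "0 < (norm (F z + 1))\<^sup>2 * (norm (F w + 1))\<^sup>2" using nz assms by simp
  have "4 * (norm (F z + cnj (F w)))\<^sup>2 * ((1 - (norm z)\<^sup>2) * (1 - (norm w)\<^sup>2)) / ((norm (F z + 1))\<^sup>2 * (norm (F w + 1))\<^sup>2)
     \<le> (norm (1 - cnj w * z))\<^sup>2 * (16 * Re (F z) * Re (F w)) / ((norm (F z + 1))\<^sup>2 * (norm (F w + 1))\<^sup>2)"
    using schwarz_pick[OF holo maps assms(3,4)]
    unfolding key id[OF assms(3)] id[OF assms(4)] norm_divide norm_mult complex_mod_cnj
    by (simp add: power_divide power_mult_distrib mult_ac)
  then have 1: "(norm (F z + cnj (F w)))\<^sup>2 * ((1 - (norm z)\<^sup>2) * (1 - (norm w)\<^sup>2))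
     \<le> (norm (1 - cnj w * z))\<^sup>2 * (4 * Re (F z) * Re (F w))"
    using P by (simp only: divide_le_cancel) (simp add: mult_ac)
  have "Re (F w) \<le> Re (F z + cnj (F w))" using assms(2)[OF assms(3)] by simp
  also have "\<dots> \<le> norm (F z + cnj (F w))" by (rule complex_Re_le_cmod)
  finally have "(Re (F w))\<^sup>2 \<le> (norm (F z + cnj (F w)))\<^sup>2"
    using assms(2)[OF assms(4)] by (intro power_mono) auto
  moreover have "0 \<le> (1 - (norm z)\<^sup>2) * (1 - (norm w)\<^sup>2)"
    using assms by (simp add: abs_square_le_1)
  ultimately have "(Re (F w))\<^sup>2 * ((1 - (norm z)\<^sup>2) * (1 - (norm w)\<^sup>2)) \<le> (norm (1 - cnj w * z))\<^sup>2 * (4 * Re (F z) * Re (F w))"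
    by (rule order_trans[OF mult_right_mono 1])
  then have "Re (F w) * (Re (F w) * ((1 - (norm z)\<^sup>2) * (1 - (norm w)\<^sup>2))) \<le> Re (F w) * (4 * (norm (1 - cnj w * z))\<^sup>2 * Re (F z))"
    by (simp add: power2_eq_square mult_ac)
  then show ?thesis using assms(2)[OF assms(4)] by simp
qed

text \<open>Adding a small positive constant to \<open>F\<close> reduces a nonnegative real part to a positive one.\<close>

lemma harnack:
  assumes "F holomorphic_on ball 0 1" "\<And>z. norm z < 1 \<Longrightarrow> 0 \<le> Re (F z)" "norm z < 1" "norm w < 1"
  shows "Re (F w) * ((1 - (norm z)\<^sup>2) * (1 - (norm w)\<^sup>2)) \<le> 4 * (norm (1 - cnj w * z))\<^sup>2 * Re (F z)"
proof (rule tendsto_le[OF trivial_limit_at_right_real])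
  show "((\<lambda>e. (Re (F w) + e) * ((1 - (norm z)\<^sup>2) * (1 - (norm w)\<^sup>2))) \<longlongrightarrow>
     Re (F w) * ((1 - (norm z)\<^sup>2) * (1 - (norm w)\<^sup>2))) (at_right 0)"
    by (auto intro!: tendsto_eq_intros)
  show "((\<lambda>e. 4 * (norm (1 - cnj w * z))\<^sup>2 * (Re (F z) + e)) \<longlongrightarrow>
     4 * (norm (1 - cnj w * z))\<^sup>2 * Re (F z)) (at_right 0)"
    by (auto intro!: tendsto_eq_intros)
  have "(Re (F w) + e) * ((1 - (norm z)\<^sup>2) * (1 - (norm w)\<^sup>2)) \<le> 4 * (norm (1 - cnj w * z))\<^sup>2 * (Re (F z) + e)"
    if "e > 0" for e
  proof -
    have "(\<lambda>z. F z + of_real e) holomorphic_on ball 0 1"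
      by (intro holomorphic_intros assms)
    moreover have "0 < Re (F x + of_real e)" if "norm x < 1" for x
      using assms(2)[OF that] \<open>e > 0\<close> by simp
    ultimately show ?thesis
      using harnack_pos[of "\<lambda>z. F z + of_real e" z w] assms(3,4) by simp
  qed
  then show "\<forall>\<^sub>F e in at_right 0. (Re (F w) + e) * ((1 - (norm z)\<^sup>2) * (1 - (norm w)\<^sup>2)) \<le>
     4 * (norm (1 - cnj w * z))\<^sup>2 * (Re (F z) + e)"
    by (simp add: eventually_at_right_less eventually_at_filter)
qed

text \<open>
  By Harnack's inequality one zero of the real part forces it to vanish everywhere, and then the open
  mapping theorem leaves only constants.
\<close>

lemma zero_real_part_constant:
  assumes holo: "F holomorphic_on ball 0 1" and ge: "\<And>z. norm z < 1 \<Longrightarrow> 0 \<le> Re (F z)"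
    and z0: "norm z0 < 1" "Re (F z0) = 0"
  obtains \<alpha> :: real where "\<And>z. norm z < 1 \<Longrightarrow> F z = \<i> * of_real \<alpha>"
proof -
  have Re0: "Re (F z) = 0" if z: "norm z < 1" for z
  proof -
    have "Re (F z) * ((1 - (norm z0)\<^sup>2) * (1 - (norm z)\<^sup>2)) \<le> 0"
      using harnack[OF holo ge z0(1) z] z0 by simp
    moreover have "0 < (1 - (norm z0)\<^sup>2) * (1 - (norm z)\<^sup>2)"
      using z z0 by (simp add: abs_square_less_1)
    ultimately have "\<not> 0 < Re (F z)" by (metis mult_pos_pos not_less)
    then show ?thesis using ge[OF z] by linarith
  qed
  have "F constant_on ball 0 1"
  proof (rule ccontr)
    assume "\<not> F constant_on ball 0 1"
    then have op: "open (F ` ball 0 1)"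
      by (intro open_mapping_thm[OF holo]) auto
    have "F 0 \<in> F ` ball 0 1" by auto
    then obtain e where e: "e > 0" "ball (F 0) e \<subseteq> F ` ball 0 1"
      using op open_contains_ball by blast
    have "F 0 + of_real (e / 2) \<in> ball (F 0) e" using e by (simp add: dist_norm)
    then obtain z where "norm z < 1" "F z = F 0 + of_real (e / 2)" using e(2) by fastforce
    then show False using Re0[of z] Re0[of 0] e by simp
  qed
  then obtain c where c: "\<And>z. norm z < 1 \<Longrightarrow> F z = c" by (auto simp: constant_on_def)
  then have "Re c = 0" using Re0[of 0] by simp
  then have "c = \<i> * of_real (Im c)" by (simp add: complex_eq_iff)
  then show ?thesis using c that by metis
qed

lemma radial_tendsto:
  fixes \<sigma> :: complex
  shows "((\<lambda>r. of_real r * \<sigma>) \<longlongrightarrow> \<sigma>) (at_left (1::real))"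
  by (auto intro!: tendsto_eq_intros)

lemma eventually_radial: "eventually (\<lambda>r. 0 < r \<and> r < (1::real)) (at_left 1)"
  using eventually_at_left_real[of 0 "1::real"] by (simp add: eventually_mono)

lemma eventually_radial_in_disc:
  assumes "norm \<sigma> = 1" shows "eventually (\<lambda>r. norm (of_real r * \<sigma> :: complex) < 1) (at_left 1)"
  using eventually_radial by eventually_elim (use assms in \<open>simp add: norm_mult\<close>)

lemma herglotz_radial_pole:
  assumes "norm \<sigma> = 1"
  shows "((\<lambda>r. of_real (1 - r) * herglotz \<sigma> (of_real r * \<sigma>)) \<longlongrightarrow> 2) (at_left 1)"
proof -
  have "((\<lambda>r. of_real (1 + r) :: complex) \<longlongrightarrow> 2) (at_left 1)"
    by (auto intro!: tendsto_eq_intros)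
  moreover have "\<forall>\<^sub>F r in at_left 1. of_real (1 + r) = of_real (1 - r) * herglotz \<sigma> (of_real r * \<sigma>)"
    using eventually_radial
  proof eventually_elim
    case (elim r)
    have "\<sigma> \<noteq> 0" "1 - of_real r \<noteq> (0::complex)" using assms elim by auto
    moreover have "herglotz \<sigma> (of_real r * \<sigma>) = (\<sigma> * (1 + of_real r)) / (\<sigma> * (1 - of_real r))"
      by (simp add: herglotz_def algebra_simps)
    ultimately show ?case by simp
  qed
  ultimately show ?thesis by (rule Lim_transform_eventually)
qed

lemma herglotz_radial_regular:
  assumes "\<sigma> \<noteq> \<tau>"
  shows "((\<lambda>r. of_real (1 - r) * herglotz \<tau> (of_real r * \<sigma>)) \<longlongrightarrow> 0) (at_left 1)"
  unfolding herglotz_def using assms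
  by (auto intro!: tendsto_eq_intros radial_tendsto)

text \<open>
  In the language of the Herglotz measure of \<open>F\<close>: if each point \<open>\<sigma> j\<close> carries mass at least \<open>m j\<close>,
  then subtracting these masses leaves a positive measure.
\<close>

lemma herglotz_atoms_add:
  fixes \<sigma> :: "'i \<Rightarrow> complex"
  assumes "finite J" and holo: "F holomorphic_on ball 0 1" and "inj_on \<sigma> J"
    and "\<And>j. j \<in> J \<Longrightarrow> norm (\<sigma> j) = 1" 
    and "\<And>z. norm z < 1 \<Longrightarrow> 0 \<le> Re (F z)"
    and "\<And>j z. j \<in> J \<Longrightarrow> norm z < 1 \<Longrightarrow> m j * Re (herglotz (\<sigma> j) z) \<le> Re (F z)"
    and "norm z < 1"
  shows "(\<Sum>j\<in>J. m j * Re (herglotz (\<sigma> j) z)) \<le> Re (F z)"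
  using assms(1,3-)
proof (induction J arbitrary: z rule: finite_induct)
  case empty
  then show ?case by simp
next
  case (insert i J)
  \<comment> \<open>The kernels already subtracted do not blow up at the new point, so along its radius the remainder
      \<open>E\<close> still grows at least like \<open>2 * m i / (1 - r)\<close>.\<close>
  define E where "E = (\<lambda>z. F z - (\<Sum>j\<in>J. of_real (m j) * herglotz (\<sigma> j) z))"
  have E_holo: "E holomorphic_on ball 0 1"
    unfolding E_def using insert.prems by (intro holomorphic_intros holo herglotz_holomorphic) auto
  have E_ge: "0 \<le> Re (E x)" if "norm x < 1" for x
  proof -
    have "(\<Sum>j\<in>J. m j * Re (herglotz (\<sigma> j) x)) \<le> Re (F x)"
      by (rule insert.IH) (use insert.prems that in auto)
    then show ?thesis by (simp add: E_def)
  qed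
  have \<sigma>i: "norm (\<sigma> i) = 1" using insert.prems by auto
  have neq: "\<sigma> i \<noteq> \<sigma> j" if "j \<in> J" for j
    using insert.prems(1) insert.hyps that by (auto simp: inj_on_def)
  have nz: "\<sigma> i \<noteq> z" using \<sigma>i insert.prems by auto
  define u where "u = (\<lambda>r. m i * Re (of_real (1 - r) * herglotz (\<sigma> i) (of_real r * \<sigma> i))
        - (\<Sum>j\<in>J. m j * Re (of_real (1 - r) * herglotz (\<sigma> j) (of_real r * \<sigma> i))))"
  have u_lim: "(u \<longlongrightarrow> m i * Re 2 - (\<Sum>j\<in>J. m j * Re 0)) (at_left 1)"
    unfolding u_def by (intro tendsto_intros herglotz_radial_pole herglotz_radial_regular \<sigma>i neq)
  \<comment> \<open>Harnack's inequality between \<open>z\<close> and \<open>r * \<sigma> i\<close> carries this growth to \<open>z\<close> as \<open>r\<close> tends to 1.\<close>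
  have "m i * Re (herglotz (\<sigma> i) z) \<le> Re (E z)"
  proof (rule tendsto_le)
    show "((\<lambda>r. Re (E z)) \<longlongrightarrow> Re (E z)) (at_left (1::real))" by simp
    show "((\<lambda>r. u r * (1 + r) * (1 - (norm z)\<^sup>2) / (4 * (norm (1 - cnj (of_real r * \<sigma> i) * z))\<^sup>2)) \<longlongrightarrow> m i * Re (herglotz (\<sigma> i) z)) (at_left 1)"
    proof (rule tendsto_eq_rhs)
      show "((\<lambda>r. u r * (1 + r) * (1 - (norm z)\<^sup>2) / (4 * (norm (1 - cnj (of_real r * \<sigma> i) * z))\<^sup>2)) \<longlongrightarrow>
          (m i * Re 2 - (\<Sum>j\<in>J. m j * Re 0)) * (1 + 1) * (1 - (norm z)\<^sup>2) / (4 * (norm (1 - cnj (\<sigma> i) * z))\<^sup>2)) (at_left 1)"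
        by (intro tendsto_intros u_lim radial_tendsto) (use nz norm_unit_diff[OF \<sigma>i, of z] in simp)
    qed (simp add: Re_herglotz \<sigma>i norm_unit_diff)
    show "\<forall>\<^sub>F r in at_left 1. u r * (1 + r) * (1 - (norm z)\<^sup>2) / (4 * (norm (1 - cnj (of_real r * \<sigma> i) * z))\<^sup>2) \<le> Re (E z)"
      using eventually_radial
    proof eventually_elim
      case (elim r)
      let ?w = "of_real r * \<sigma> i"
      have nw: "norm ?w = r" using elim \<sigma>i by (simp add: norm_mult)
      then have w1: "norm ?w < 1" using elim by simp
      have "m i * Re (herglotz (\<sigma> i) ?w) \<le> Re (F ?w)" using insert.prems w1 by auto
      then have "(1 - r) * (m i * Re (herglotz (\<sigma> i) ?w)) \<le> (1 - r) * Re (F ?w)" using elim by simp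
      then have "u r \<le> (1 - r) * Re (E ?w)"
        by (simp add: u_def E_def algebra_simps sum_distrib_left Re_sum)
      then have "u r * ((1 + r) * (1 - (norm z)\<^sup>2)) \<le> (1 - r) * Re (E ?w) * ((1 + r) * (1 - (norm z)\<^sup>2))"
        using elim insert.prems by (intro mult_right_mono) (auto simp: abs_square_le_1)
      also have "\<dots> = Re (E ?w) * ((1 - (norm z)\<^sup>2) * (1 - (norm ?w)\<^sup>2))"
        unfolding nw by (simp add: algebra_simps power2_eq_square)
      also have "\<dots> \<le> 4 * (norm (1 - cnj ?w * z))\<^sup>2 * Re (E z)"
        by (rule harnack[OF E_holo E_ge _ w1]) (use insert.prems in auto)
      finally show ?case
        using one_minus_cnj_mult_neq_0[OF w1, of z] insert.prems
        by (simp add: field_simps)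
    qed
  qed auto
  then show ?case using insert.hyps by (simp add: E_def algebra_simps Re_sum)
qed

text \<open>
  Julia's lemma read in the half-plane. The limit \<open>b\<close> is positive because a boundary point cannot be
  approached infinitely fast: for \<open>b \<le> 0\<close> the inequality at \<open>z = 0\<close> would give \<open>H 0 = 1\<close>.
\<close>

lemma julia_herglotz:
  assumes holo: "H holomorphic_on ball 0 1" and maps: "H ` ball 0 1 \<subseteq> ball 0 1"
    and \<sigma>: "norm \<sigma> = 1"
    and lim: "((\<lambda>r. H (of_real r * \<sigma>)) \<longlongrightarrow> 1) (at_left 1)"
    and rate: "((\<lambda>r. (1 - (norm (H (of_real r * \<sigma>)))\<^sup>2) / (1 - r\<^sup>2)) \<longlongrightarrow> b) (at_left 1)"
  shows "0 < b"
    and "norm z < 1 \<Longrightarrow> 1 / b * Re (herglotz \<sigma> z) \<le> Re (cayley (H z))"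
proof -
  have key: "(norm (1 - H z))\<^sup>2 * (1 - (norm z)\<^sup>2) \<le> b * (norm (\<sigma> - z))\<^sup>2 * (1 - (norm (H z))\<^sup>2)"
    if "norm z < 1" for z
  proof -
    have "\<forall>\<^sub>F r in at_left 1. (1 - (norm (H (of_real r * \<sigma>)))\<^sup>2) / (1 - (norm (of_real r * \<sigma>))\<^sup>2)
        \<le> (1 - (norm (H (of_real r * \<sigma>)))\<^sup>2) / (1 - r\<^sup>2)"
      using \<sigma> by (simp add: norm_mult)
    from julia[OF holo maps that trivial_limit_at_left_real eventually_radial_in_disc[OF \<sigma>]
        radial_tendsto lim rate this]
    show ?thesis by (simp add: norm_unit_diff[OF \<sigma>])
  qed
  have lt: "norm (H z) < 1" if "norm z < 1" for z
    using self_map_norm_less[OF maps that] .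
  have neq: "H z \<noteq> 1" if "norm z < 1" for z
    using lt[OF that] by auto
  have "0 < (norm (1 - H 0))\<^sup>2" using neq[of 0] by simp
  also have "\<dots> \<le> b * (1 - (norm (H 0))\<^sup>2)" using key[of 0] \<sigma> by simp
  finally show b: "0 < b"
    using lt[of 0] zero_less_mult_pos2[of b "1 - (norm (H 0))\<^sup>2"] by (simp add: abs_square_less_1)
  assume z: "norm z < 1"
  have "\<sigma> \<noteq> z" using \<sigma> z by auto
  then show "1 / b * Re (herglotz \<sigma> z) \<le> Re (cayley (H z))"
    using key[OF z] b neq[OF z] unfolding Re_herglotz[OF \<sigma>] Re_cayley
    by (simp add: divide_simps mult_ac)
qed

lemma radial_in_stolz_region:
  assumes "norm \<sigma> = 1" "M > 1"
  shows "filterlim (\<lambda>r. of_real r * \<sigma>) (at \<sigma> within stolz_region \<sigma> M) (at_left 1)"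
proof -
  have "\<forall>\<^sub>F r in at_left 1. of_real r * \<sigma> \<in> stolz_region \<sigma> M \<and> of_real r * \<sigma> \<noteq> \<sigma>"
    using eventually_radial
  proof eventually_elim
    case (elim r)
    have "norm (\<sigma> - of_real r * \<sigma>) = norm ((1 - of_real r) * \<sigma>)" by (simp add: algebra_simps)
    also have "\<dots> = norm (of_real (1 - r) :: complex)" using assms by (simp add: norm_mult)
    also have "\<dots> = 1 - r" using elim by (simp only: norm_of_real) simp
    finally have 1: "norm (\<sigma> - of_real r * \<sigma>) = 1 - r" .
    moreover have "norm (of_real r * \<sigma>) = r" using elim assms by (simp add: norm_mult)
    ultimately show ?case using elim assms by (auto simp: stolz_region_def)
  qed
  then show ?thesis
    by (simp add: filterlim_at radial_tendsto)
qed

text \<open>The radius lies in every Stolz region, so the radial limit determines the boundary value.\<close>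

lemma boundary_value_eqI:
  assumes "norm \<sigma> = 1" "has_nontangential_limit f \<sigma> l"
  shows "boundary_value f \<sigma> = l"
    and "((\<lambda>r. f (of_real r * \<sigma>)) \<longlongrightarrow> l) (at_left 1)"
proof -
  have rad: "((\<lambda>r. f (of_real r * \<sigma>)) \<longlongrightarrow> l) (at_left 1)" if "has_nontangential_limit f \<sigma> l" for l
  proof -
    have "(f \<longlongrightarrow> l) (at \<sigma> within stolz_region \<sigma> 2)"
      using that by (simp add: has_nontangential_limit_def)
    then show ?thesis
      by (rule filterlim_compose) (rule radial_in_stolz_region[OF assms(1)], simp)
  qed
  then show "((\<lambda>r. f (of_real r * \<sigma>)) \<longlongrightarrow> l) (at_left 1)" using assms by blast
  show "boundary_value f \<sigma> = l"
    unfolding boundary_value_def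
    by (rule the_equality) (use assms rad tendsto_unique[OF trivial_limit_at_left_real] in blast)+
qed

text \<open>
  The part of the Julia--Caratheodory theorem that is needed: where the dilation coefficient is finite,
  the boundary value exists and the lower limit is a limit along the radius. The dilation quotient is
  stated with squared moduli, which are rational in \<open>f\<close>; since both \<open>|f|\<close> and \<open>|z|\<close> tend to 1, squaring
  does not change the limit.
\<close>

lemma boundary_dilation_radial:
  assumes holo: "f holomorphic_on ball 0 1" and maps: "f ` ball 0 1 \<subseteq> ball 0 1"
    and \<sigma>: "norm \<sigma> = 1" and fin: "boundary_dilation f \<sigma> < \<infinity>"
  shows "norm (boundary_value f \<sigma>) = 1"
    and "((\<lambda>r. f (of_real r * \<sigma>)) \<longlongrightarrow> boundary_value f \<sigma>) (at_left 1)"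
    and "((\<lambda>r. (1 - (norm (f (of_real r * \<sigma>)))\<^sup>2) / (1 - r\<^sup>2)) \<longlongrightarrow>
            real_of_ereal (boundary_dilation f \<sigma>)) (at_left 1)"
proof -
  let ?q = "\<lambda>z. (1 - norm (f z)) / (1 - norm z)"
  let ?D = "at \<sigma> within ball 0 1"
  define b where "b = real_of_ereal (boundary_dilation f \<sigma>)"
  have lt: "norm (f z) < 1" if "norm z < 1" for z
    using self_map_norm_less[OF maps that] .
  have "0 \<le> boundary_dilation f \<sigma>"
    unfolding boundary_dilation_def
    by (rule Liminf_bounded, unfold eventually_at_filter)
       (auto intro!: always_eventually divide_nonneg_nonneg less_imp_le[OF lt])
  then have dil: "boundary_dilation f \<sigma> = ereal b" and b0: "0 \<le> b"
    using fin unfolding b_def by (cases "boundary_dilation f \<sigma>"; simp)+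
  have below: "\<forall>\<^sub>F z in ?D. a < ?q z" if "a < b" for a
  proof -
    have "ereal a < boundary_dilation f \<sigma>" using dil that by simp
    then show ?thesis unfolding boundary_dilation_def
      by (auto dest!: less_LiminfD)
  qed
  have ex: "\<exists>z. norm z < 1 \<and> dist z \<sigma> < e \<and> ?q z < b + e" if e: "e > 0" for e
  proof (rule ccontr)
    assume "\<not> ?thesis"
    then have "\<forall>z. norm z < 1 \<and> dist z \<sigma> < e \<longrightarrow> b + e \<le> ?q z" by (meson not_less)
    then have "\<forall>\<^sub>F z in ?D. ereal (b + e) \<le> ereal (?q z)"
      using e by (auto simp: eventually_at)
    then have "ereal (b + e) \<le> boundary_dilation f \<sigma>"
      unfolding boundary_dilation_def by (rule Liminf_bounded)
    then show False using dil e by simp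
  qed
  \<comment> \<open>Along a sequence on which the lower limit is attained, compactness provides a candidate \<open>l\<close> for
      the boundary value; Julia's inequality then forces convergence to \<open>l\<close> in every Stolz region.\<close>
  define \<epsilon> where "\<epsilon> = (\<lambda>n. inverse (real (Suc n)))"
  have \<epsilon>0: "\<epsilon> \<longlonglongrightarrow> 0" unfolding \<epsilon>_def by (rule LIMSEQ_inverse_real_of_nat)
  have "\<forall>n. \<exists>z. norm z < 1 \<and> dist z \<sigma> < \<epsilon> n \<and> ?q z < b + \<epsilon> n"
    using ex by (auto simp: \<epsilon>_def)
  then obtain s where s: "\<And>n. norm (s n) < 1" "\<And>n. dist (s n) \<sigma> < \<epsilon> n" "\<And>n. ?q (s n) < b + \<epsilon> n"
    by metis
  have s_lim: "s \<longlonglongrightarrow> \<sigma>"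
    by (rule metric_tendsto_imp_tendsto[OF \<epsilon>0]) (use s(2) in \<open>auto simp: dist_norm \<epsilon>_def intro!: always_eventually less_imp_le\<close>)
  have "bounded (range (\<lambda>n. f (s n)))"
    using lt s(1) by (auto simp: bounded_iff intro!: exI[of _ 1] less_imp_le)
  then obtain l t where t: "strict_mono (t :: nat \<Rightarrow> nat)" and l: "((\<lambda>n. f (s n)) \<circ> t) \<longlonglongrightarrow> l"
    using bounded_imp_convergent_subsequence by blast
  define w where "w = (\<lambda>n. s (t n))"
  define e where "e = (\<lambda>n. \<epsilon> (t n))"
  have w_lim: "w \<longlonglongrightarrow> \<sigma>" and e_lim: "e \<longlonglongrightarrow> 0" and fw_lim: "(\<lambda>n. f (w n)) \<longlonglongrightarrow> l"
    using LIMSEQ_subseq_LIMSEQ[OF s_lim t] LIMSEQ_subseq_LIMSEQ[OF \<epsilon>0 t] l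
    by (simp_all add: o_def w_def e_def)
  have w: "norm (w n) < 1" "?q (w n) \<le> b + e n" for n
    using s by (auto simp: w_def e_def intro: less_imp_le)
  have norm_w: "(\<lambda>n. norm (w n)) \<longlonglongrightarrow> 1"
    using tendsto_norm[OF w_lim] \<sigma> by simp
  have norm_fw: "(\<lambda>n. norm (f (w n))) \<longlonglongrightarrow> 1"
  proof (rule tendsto_sandwich)
    show "\<forall>\<^sub>F n in sequentially. 1 - (b + e n) * (1 - norm (w n)) \<le> norm (f (w n))"
      using w by (auto simp: pos_divide_le_eq algebra_simps intro!: always_eventually)
    show "\<forall>\<^sub>F n in sequentially. norm (f (w n)) \<le> 1"
      using w lt by (auto intro!: always_eventually less_imp_le)
    have "(\<lambda>n. 1 - (b + e n) * (1 - norm (w n))) \<longlonglongrightarrow> 1 - (b + 0) * (1 - 1)"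
      by (intro tendsto_intros e_lim norm_w)
    then show "(\<lambda>n. 1 - (b + e n) * (1 - norm (w n))) \<longlonglongrightarrow> 1" by simp
  qed auto
  have norm_l: "norm l = 1"
    using LIMSEQ_unique[OF tendsto_norm[OF fw_lim] norm_fw] .
  have julia: "(norm (l - f z))\<^sup>2 * (1 - (norm z)\<^sup>2) \<le> b * (norm (\<sigma> - z))\<^sup>2 * (1 - (norm (f z))\<^sup>2)"
    if z: "norm z < 1" for z
  proof -
    have "(\<lambda>n. (b + e n) * ((1 + norm (f (w n))) / (1 + norm (w n)))) \<longlonglongrightarrow> (b + 0) * ((1 + 1) / (1 + 1))"
      by (intro tendsto_intros e_lim norm_w norm_fw) auto
    then have u: "(\<lambda>n. (b + e n) * ((1 + norm (f (w n))) / (1 + norm (w n)))) \<longlonglongrightarrow> b" by simp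
    have "(1 - (norm (f (w n)))\<^sup>2) / (1 - (norm (w n))\<^sup>2) \<le> (b + e n) * ((1 + norm (f (w n))) / (1 + norm (w n)))" for n
    proof -
      have "(1 - (norm (f (w n)))\<^sup>2) / (1 - (norm (w n))\<^sup>2) = ?q (w n) * ((1 + norm (f (w n))) / (1 + norm (w n)))"
        by (simp add: power2_eq_square algebra_simps)
      also have "\<dots> \<le> (b + e n) * ((1 + norm (f (w n))) / (1 + norm (w n)))"
        by (intro mult_right_mono w divide_nonneg_nonneg) auto
      finally show ?thesis .
    qed
    then have "\<forall>\<^sub>F n in sequentially. (1 - (norm (f (w n)))\<^sup>2) / (1 - (norm (w n))\<^sup>2) \<le> (b + e n) * ((1 + norm (f (w n))) / (1 + norm (w n)))"
      by simp
    from julia[OF holo maps z _ _ w_lim fw_lim u this]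
    show ?thesis using w(1) by (simp add: norm_unit_diff \<sigma> norm_l)
  qed
  have "has_nontangential_limit f \<sigma> l"
    unfolding has_nontangential_limit_def
  proof (intro allI impI)
    fix M :: real assume M: "M > 1"
    let ?S = "at \<sigma> within stolz_region \<sigma> M"
    have "((\<lambda>z. (norm (f z - l))\<^sup>2) \<longlongrightarrow> 0) ?S"
    proof (rule tendsto_sandwich)
      show "\<forall>\<^sub>F z in ?S. 0 \<le> (norm (f z - l))\<^sup>2" by simp
      have "(norm (f z - l))\<^sup>2 \<le> b * M * norm (\<sigma> - z)" if "z \<in> stolz_region \<sigma> M" for z
      proof -
        have z: "norm z < 1" and le: "norm (\<sigma> - z) \<le> M * (1 - norm z)"
          using that by (auto simp: stolz_region_def)
        have "(norm (f z - l))\<^sup>2 * (1 - norm z) \<le> (norm (l - f z))\<^sup>2 * (1 - (norm z)\<^sup>2)"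
          unfolding norm_minus_commute[of l]
          by (rule mult_left_mono) (use z in \<open>auto simp: power2_eq_square mult_left_le\<close>)
        also have "\<dots> \<le> b * (norm (\<sigma> - z))\<^sup>2 * (1 - (norm (f z))\<^sup>2)" by (rule julia[OF z])
        also have "\<dots> \<le> b * (norm (\<sigma> - z))\<^sup>2 * 1"
          by (intro mult_left_mono) (use b0 in auto)
        also have "\<dots> = b * norm (\<sigma> - z) * norm (\<sigma> - z)" by (simp add: power2_eq_square)
        also have "\<dots> \<le> b * norm (\<sigma> - z) * (M * (1 - norm z))"
          by (intro mult_left_mono le) (use b0 in auto)
        also have "\<dots> = (b * M * norm (\<sigma> - z)) * (1 - norm z)" by simp
        finally show ?thesis using z by (simp only: mult_le_cancel_right)
      qed
      then show "\<forall>\<^sub>F z in ?S. (norm (f z - l))\<^sup>2 \<le> b * M * norm (\<sigma> - z)"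
        by (auto simp: eventually_at_filter intro: always_eventually)
      have "((\<lambda>z. b * M * norm (\<sigma> - z)) \<longlongrightarrow> b * M * norm (\<sigma> - \<sigma>)) ?S"
        by (intro tendsto_intros)
      then show "((\<lambda>z. b * M * norm (\<sigma> - z)) \<longlongrightarrow> 0) ?S" by simp
    qed simp
    then have "((\<lambda>z. sqrt ((norm (f z - l))\<^sup>2)) \<longlongrightarrow> sqrt 0) ?S" by (rule tendsto_real_sqrt)
    then have "((\<lambda>z. norm (f z - l)) \<longlongrightarrow> 0) ?S" by simp
    then show "(f \<longlongrightarrow> l) ?S" by (simp add: LIM_zero_cancel tendsto_norm_zero_iff)
  qed
  from boundary_value_eqI[OF \<sigma> this] have bv: "boundary_value f \<sigma> = l"
    and rad: "((\<lambda>r. f (of_real r * \<sigma>)) \<longlongrightarrow> l) (at_left 1)" by auto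
  show "norm (boundary_value f \<sigma>) = 1" using bv norm_l by simp
  show "((\<lambda>r. f (of_real r * \<sigma>)) \<longlongrightarrow> boundary_value f \<sigma>) (at_left 1)" using bv rad by simp
  let ?f = "\<lambda>r. norm (f (of_real r * \<sigma>))"
  have nf: "(?f \<longlongrightarrow> 1) (at_left 1)" using tendsto_norm[OF rad] norm_l by simp
  have "((\<lambda>r. (1 - ?f r) / (1 - r)) \<longlongrightarrow> b) (at_left 1)"
  proof (rule order_tendstoI)
    \<comment> \<open>A limit along the radius is at least the lower limit over the whole disc.\<close>
    fix a assume "a < b"
    have "filterlim (\<lambda>r. of_real r * \<sigma>) ?D (at_left 1)"
      unfolding filterlim_at
    proof
      show "\<forall>\<^sub>F r in at_left 1. of_real r * \<sigma> \<in> ball 0 1 \<and> of_real r * \<sigma> \<noteq> \<sigma>"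
        using eventually_radial_in_disc[OF \<sigma>] by eventually_elim (use \<sigma> in auto)
    qed (rule radial_tendsto)
    from eventually_compose_filterlim[OF below[OF \<open>a < b\<close>] this] eventually_radial
    show "\<forall>\<^sub>F r in at_left 1. a < (1 - ?f r) / (1 - r)"
      by eventually_elim (use \<sigma> in \<open>simp add: norm_mult\<close>)
  next
    \<comment> \<open>On the radius \<open>|\<sigma> - z| = 1 - r\<close>, and \<open>|l - f z| \<ge> 1 - |f z|\<close>, so Julia's inequality bounds
        the quotient by \<open>b\<close> times a factor that tends to 1.\<close>
    fix a assume "b < a"
    have "((\<lambda>r. b * ((1 + ?f r) / (1 + r))) \<longlongrightarrow> b * ((1 + 1) / (1 + 1))) (at_left 1)"
      by (intro tendsto_intros nf) auto
    then have "\<forall>\<^sub>F r in at_left 1. b * ((1 + ?f r) / (1 + r)) < a"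
      using \<open>b < a\<close> by (intro order_tendstoD) auto
    then show "\<forall>\<^sub>F r in at_left 1. (1 - ?f r) / (1 - r) < a"
      using eventually_radial
    proof eventually_elim
      case (elim r)
      let ?z = "of_real r * \<sigma>"
      have nz: "norm ?z = r" using elim \<sigma> by (simp add: norm_mult)
      then have z1: "norm ?z < 1" using elim by simp
      have "norm (\<sigma> - ?z) = norm (of_real (1 - r) * \<sigma>)" by (simp add: algebra_simps)
      also have "\<dots> = 1 - r" using elim \<sigma> by (simp only: norm_mult norm_of_real) simp
      finally have d: "norm (\<sigma> - ?z) = 1 - r" .
      have f1: "?f r < 1" by (rule lt[OF z1])
      have "(1 - ?f r)\<^sup>2 \<le> (norm (l - f ?z))\<^sup>2"
        using norm_triangle_ineq2[of l "f ?z"] norm_l f1 by (intro power_mono) auto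
      then have "(1 - ?f r)\<^sup>2 * (1 - r\<^sup>2) \<le> (norm (l - f ?z))\<^sup>2 * (1 - r\<^sup>2)"
        using elim by (intro mult_right_mono) (auto simp: abs_square_le_1)
      also have "\<dots> \<le> b * (1 - r)\<^sup>2 * (1 - (?f r)\<^sup>2)"
        using julia[OF z1] unfolding nz d .
      finally have "((1 - ?f r) * (1 - r)) * ((1 - ?f r) * (1 + r)) \<le> ((1 - ?f r) * (1 - r)) * (b * (1 - r) * (1 + ?f r))"
        by (simp add: power2_eq_square algebra_simps)
      then have "(1 - ?f r) * (1 + r) \<le> b * (1 - r) * (1 + ?f r)"
        using elim f1 by (subst (asm) mult_le_cancel_left_pos) auto
      then have "(1 - ?f r) / (1 - r) \<le> b * ((1 + ?f r) / (1 + r))"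
        using elim by (simp add: field_simps)
      then show ?case using elim by linarith
    qed
  qed
  then have "((\<lambda>r. (1 - ?f r) / (1 - r) * ((1 + ?f r) / (1 + r))) \<longlongrightarrow> b * ((1 + 1) / (1 + 1))) (at_left 1)"
    by (intro tendsto_intros nf) auto
  moreover have "(1 - ?f r) / (1 - r) * ((1 + ?f r) / (1 + r)) = (1 - (?f r)\<^sup>2) / (1 - r\<^sup>2)" for r
    by (simp add: power2_eq_square algebra_simps)
  ultimately show "((\<lambda>r. (1 - (?f r)\<^sup>2) / (1 - r\<^sup>2)) \<longlongrightarrow> real_of_ereal (boundary_dilation f \<sigma>)) (at_left 1)"
    by (simp add: b_def)
qed

section \<open>Blaschke products as quotients of conjugate reciprocal polynomials\<close>

text \<open>
  The relation says that \<open>q\<close> is the conjugate reciprocal polynomial of \<open>p\<close> with respect to the formal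
  degree \<open>d\<close>, that is, the coefficients are reversed and conjugated. As a relation between values it
  passes to sums, products and conjugate-linear combinations at once; the actual degree of \<open>p\<close> may be
  smaller than \<open>d\<close>.
\<close>

definition reciprocal_pair :: "nat \<Rightarrow> complex poly \<Rightarrow> complex poly \<Rightarrow> bool" where
  "reciprocal_pair d p q \<longleftrightarrow> degree p \<le> d \<and> degree q \<le> d \<and>
     (\<forall>z. z \<noteq> 0 \<longrightarrow> poly q z = z ^ d * cnj (poly p (1 / cnj z)))"

lemma poly_eqI_nonzero:
  fixes p q :: "complex poly"
  assumes "\<And>z. z \<noteq> 0 \<Longrightarrow> poly p z = poly q z"
  shows "p = q"
proof (rule ccontr)
  assume "p \<noteq> q"
  then have "finite {z. poly (p - q) z = 0}" by (intro poly_roots_finite) simp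
  moreover have "- {0} \<subseteq> {z. poly (p - q) z = 0}" using assms by auto
  ultimately have "finite (- {0 :: complex})" by (rule finite_subset[rotated])
  then have "finite (UNIV :: complex set)" by (metis finite.insertI finite.emptyI finite_compl)
  then show False by (simp add: infinite_UNIV_char_0)
qed

lemma reciprocal_pair_sym:
  assumes "reciprocal_pair d p q"
  shows "z \<noteq> 0 \<Longrightarrow> poly p z = z ^ d * cnj (poly q (1 / cnj z))"
  using assms by (auto simp: reciprocal_pair_def field_simps)

lemma reciprocal_pair_add:
  assumes "reciprocal_pair d p q" "reciprocal_pair d p' q'"
  shows "reciprocal_pair d (p + p') (q + q')"
  using assms by (auto simp: reciprocal_pair_def algebra_simps intro: degree_add_le)

lemma reciprocal_pair_smult:
  assumes "reciprocal_pair d p q"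
  shows "reciprocal_pair d (smult c p) (smult (cnj c) q)"
  using assms degree_smult_le[of c p] degree_smult_le[of "cnj c" q]
  by (auto simp: reciprocal_pair_def)

lemma reciprocal_pair_swap:
  assumes "reciprocal_pair d p q"
  shows "reciprocal_pair d q p"
  using assms reciprocal_pair_sym[OF assms] by (auto simp: reciprocal_pair_def)

lemma reciprocal_pair_mult:
  assumes "reciprocal_pair d p q" "reciprocal_pair e p' q'"
  shows "reciprocal_pair (d + e) (p * p') (q * q')"
  using assms degree_mult_le[of p p'] degree_mult_le[of q q']
  by (auto simp: reciprocal_pair_def power_add)

lemma reciprocal_pair_linear: "reciprocal_pair 1 [:- a, 1:] [:1, - cnj a:]"
  by (auto simp: reciprocal_pair_def algebra_simps)

lemma reciprocal_pair_linear_factors: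
  "reciprocal_pair (size A) (\<Prod>a\<in>#A. [:- a, 1:]) (\<Prod>a\<in>#A. [:1, - cnj a:])"
proof (induction A)
  case empty
  then show ?case by (simp add: reciprocal_pair_def)
next
  case (add a A)
  then show ?case using reciprocal_pair_mult[OF reciprocal_pair_linear add] by simp
qed

text \<open>
  A multiset of zeros avoids reindexing when factors are added or removed.
\<close>

lemma blaschke_product_mset:
  "blaschke_product d B \<longleftrightarrow> (\<exists>c A. norm c = 1 \<and> size A = d \<and> (\<forall>a\<in>#A. norm a < 1) \<and>
     (\<forall>z\<in>ball 0 1. B z = c * (\<Prod>a\<in>#A. disc_aut a z)))" (is "?L \<longleftrightarrow> ?R")
proof
  assume ?L
  then obtain \<theta> :: real and a :: "nat \<Rightarrow> complex" where a: "\<forall>j\<in>{1..d}. a j \<in> ball 0 1"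
    and B: "\<forall>z\<in>ball 0 1. B z = exp (\<i> * of_real \<theta>) * (\<Prod>j=1..d. (z - a j) / (1 - cnj (a j) * z))"
    unfolding blaschke_product_def by blast
  let ?A = "image_mset a (mset_set {1..d})"
  have "(\<Prod>b\<in>#?A. disc_aut b z) = (\<Prod>j=1..d. (z - a j) / (1 - cnj (a j) * z))" for z
    by (simp add: image_mset.compositionality o_def disc_aut_def prod_unfold_prod_mset)
  with a B show ?R
    by (intro exI[of _ "exp (\<i> * of_real \<theta>)"] exI[of _ ?A]) auto
next
  assume ?R
  then obtain c A where c: "norm c = 1" and A: "size A = d" "\<forall>a\<in>#A. norm a < 1"
    and B: "\<forall>z\<in>ball 0 1. B z = c * (\<Prod>a\<in>#A. disc_aut a z)" by blast
  obtain xs where xs: "mset xs = A" using ex_mset by blast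
  define a where "a = (\<lambda>j. xs ! (j - 1))"
  have len: "length xs = d" using xs A by auto
  have "(\<Prod>b\<in>#A. disc_aut b z) = (\<Prod>j=1..d. (z - a j) / (1 - cnj (a j) * z))" for z
  proof -
    have "(\<Prod>b\<in>#A. disc_aut b z) = prod_list (map (\<lambda>b. disc_aut b z) xs)"
      unfolding xs[symmetric] by (metis mset_map prod_mset_prod_list)
    also have "\<dots> = (\<Prod>i = 0..<d. disc_aut (xs ! i) z)"
      by (simp add: prod.list_conv_set_nth len)
    also have "\<dots> = (\<Prod>j=1..d. disc_aut (a j) z)"
      by (rule prod.reindex_bij_witness[of _ "\<lambda>j. j - 1" Suc]) (auto simp: a_def)
    finally show ?thesis by (simp add: disc_aut_def)
  qed
  moreover have "\<forall>j\<in>{1..d}. a j \<in> ball 0 1"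
  proof
    fix j assume "j \<in> {1..d}"
    then have "a j \<in> set xs" using len by (auto simp: a_def)
    then show "a j \<in> ball 0 1" using A xs by auto
  qed
  moreover have "c = exp (\<i> * of_real (Arg c))"
    using Arg_eq[of c] c by force
  ultimately show ?L
    unfolding blaschke_product_def using B by metis
qed

lemma norm_prod_disc_aut_le:
  assumes "\<forall>a\<in>#A. norm a < 1" "norm z \<le> 1"
  shows "norm (\<Prod>a\<in>#A. disc_aut a z) \<le> 1"
  using assms(1)
proof (induction A)
  case (add a A)
  have "norm (disc_aut a z) \<le> 1"
    using norm_disc_aut_less_1[of a z] norm_disc_aut_eq_1[of a z] add.prems assms(2)
    by (cases "norm z < 1") auto
  then show ?case using add by (auto simp: norm_mult intro: mult_le_one)
qed simp

lemma prod_disc_aut_eq_poly: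
  "(\<Prod>a\<in>#A. disc_aut a z) = poly (\<Prod>a\<in>#A. [:- a, 1:]) z / poly (\<Prod>a\<in>#A. [:1, - cnj a:]) z"
proof (induction A)
  case (add a A)
  have "disc_aut a z = poly [:- a, 1:] z / poly [:1, - cnj a:] z"
    by (simp add: disc_aut_def mult.commute)
  then show ?case
    by (simp only: image_mset_add_mset prod_mset.add_mset poly_mult times_divide_times_eq add)
qed simp

text \<open>
  The unimodular constant \<open>c\<close> has to be distributed over numerator and denominator: with
  \<open>s\<^sup>2 = c\<close> and \<open>|s| = 1\<close> one has \<open>s / cnj s = c\<close>, and multiplying \<open>p\<close> by \<open>s\<close> multiplies its
  conjugate reciprocal by \<open>cnj s\<close>.
\<close>

lemma blaschke_product_imp_rational:
  assumes "blaschke_product d f"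
  obtains p q where "reciprocal_pair d p q"
    "\<And>z. norm z \<le> 1 \<Longrightarrow> poly q z \<noteq> 0"
    "\<And>z. norm z \<le> 1 \<Longrightarrow> norm (poly p z) \<le> norm (poly q z)"
    "\<And>z. norm z < 1 \<Longrightarrow> f z = poly p z / poly q z"
proof -
  obtain c A where c: "norm c = 1" and A: "size A = d" "\<forall>a\<in>#A. norm a < 1"
    and f: "\<forall>z\<in>ball 0 1. f z = c * (\<Prod>a\<in>#A. disc_aut a z)"
    using assms unfolding blaschke_product_mset by blast
  define s where "s = csqrt c"
  define p where "p = (\<Prod>a\<in>#A. [:- a, 1:])"
  define q where "q = (\<Prod>a\<in>#A. [:1, - cnj a:])"
  have s: "s\<^sup>2 = c" "norm s = 1" using c by (simp_all add: s_def)
  have s_cnj: "s / cnj s = c"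
  proof -
    have "s / cnj s = s\<^sup>2 / (cnj s * s)" using s(2) by (auto simp: power2_eq_square)
    also have "cnj s * s = 1" using s(2) by (simp add: complex_norm_square[symmetric] mult.commute)
    finally show ?thesis using s by simp
  qed
  have q: "poly q z \<noteq> 0" if "norm z \<le> 1" for z
    unfolding q_def using A(2)
  proof (induction A)
    case (add a A)
    then show ?case using one_minus_cnj_mult_neq_0[of a z] that by (simp add: mult.commute)
  qed simp
  have pq: "poly p z / poly q z = (\<Prod>a\<in>#A. disc_aut a z)" for z
    by (simp add: prod_disc_aut_eq_poly p_def q_def)
  have "norm (poly p z) \<le> norm (poly q z)" if "norm z \<le> 1" for z
  proof -
    have "norm (poly p z / poly q z) \<le> 1" unfolding pq by (rule norm_prod_disc_aut_le[OF A(2) that])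
    then show ?thesis using q[OF that] by (simp add: norm_divide divide_le_eq)
  qed
  moreover have "reciprocal_pair d (smult s p) (smult (cnj s) q)"
    unfolding p_def q_def A(1)[symmetric] by (intro reciprocal_pair_smult reciprocal_pair_linear_factors)
  moreover have "f z = poly (smult s p) z / poly (smult (cnj s) q) z" if "norm z < 1" for z
  proof -
    have "f z = (s / cnj s) * (poly p z / poly q z)" using f that by (simp add: pq s_cnj)
    then show ?thesis by simp
  qed
  ultimately show ?thesis
    using q s(2) by (intro that[of "smult s p" "smult (cnj s) q"]) (auto simp: norm_mult)
qed

text \<open>
  The value \<open>q 0 \<noteq> 0\<close> is the conjugate of the coefficient of \<open>p\<close> in degree \<open>d\<close>, so \<open>p\<close> has exactly
  \<open>d\<close> roots with multiplicity. They lie in the open disc because \<open>q\<close> vanishes at the reflection of each nonzero root.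
\<close>

lemma rational_imp_blaschke_product:
  assumes pair: "reciprocal_pair d p q" and q: "\<And>z. norm z \<le> 1 \<Longrightarrow> poly q z \<noteq> 0"
    and \<kappa>: "norm \<kappa> = 1" and f: "\<And>z. norm z < 1 \<Longrightarrow> f z = \<kappa> * (poly p z / poly q z)"
  shows "blaschke_product d f"
proof -
  define A where "A = proots p"
  define c where "c = lead_coeff p"
  define e where "e = size A"
  define r where "r = smult (cnj c) (\<Prod>a\<in>#A. [:1, - cnj a:])"
  have p: "p = smult c (\<Prod>a\<in>#A. [:- a, 1:])"
    unfolding A_def c_def by (rule complex_poly_decompose_multiset[symmetric])
  have pr: "reciprocal_pair e p r"
    unfolding r_def e_def by (subst p) (intro reciprocal_pair_smult reciprocal_pair_linear_factors)
  have "p \<noteq> 0"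
  proof
    assume "p = 0"
    then have "poly q 1 = 0" using pair by (simp add: reciprocal_pair_def)
    then show False using q[of 1] by simp
  qed
  then have e: "e \<le> d"
    using pair unfolding e_def A_def reciprocal_pair_def
    by (metis size_proots_le le_trans)
  have "q = monom 1 (d - e) * r"
  proof (rule poly_eqI_nonzero)
    fix z :: complex assume "z \<noteq> 0"
    then show "poly q z = poly (monom 1 (d - e) * r) z"
      using pair pr e by (simp add: reciprocal_pair_def poly_monom power_add[symmetric] flip: mult.assoc)
  qed
  moreover from this have "e = d"
    using q[of 0] e by (cases "d = e") (auto simp: poly_monom zero_power)
  ultimately have qr: "q = r" by simp
  have c0: "c \<noteq> 0" using \<open>p \<noteq> 0\<close> by (simp add: c_def)
  have "norm a < 1" if "a \<in># A" for a
  proof (rule ccontr)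
    assume "\<not> norm a < 1"
    then have a: "norm (1 / cnj a) \<le> 1" "a \<noteq> 0" by (auto simp: norm_divide divide_le_eq)
    have "poly q (1 / cnj a) = 0"
      unfolding qr r_def using multi_member_split[OF that] a by auto
    then show False using q[OF a(1)] by simp
  qed
  moreover have "f z = (\<kappa> * (c / cnj c)) * (\<Prod>a\<in>#A. disc_aut a z)" if "norm z < 1" for z
    unfolding f[OF that] qr r_def prod_disc_aut_eq_poly by (subst p) simp
  moreover have "norm (\<kappa> * (c / cnj c)) = 1" using c0 \<kappa> by (simp add: norm_mult norm_divide)
  ultimately show ?thesis
    unfolding blaschke_product_mset using \<open>e = d\<close> e_def
    by (intro exI[of _ "\<kappa> * (c / cnj c)"] exI[of _ A]) auto
qed

text \<open>
  For \<open>f = p / q\<close> the composition is \<open>(p - a q) / (q - cnj a p)\<close>, again a reciprocal pair for the same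
  \<open>d\<close>; the denominator has no zero since \<open>|p| \<le> |q|\<close> and \<open>|a| < 1\<close>.
\<close>

lemma blaschke_product_disc_aut:
  assumes "norm a < 1" "blaschke_product d f"
  shows "blaschke_product d (\<lambda>z. disc_aut a (f z))"
proof -
  obtain p q where pq: "reciprocal_pair d p q"
    "\<And>z. norm z \<le> 1 \<Longrightarrow> poly q z \<noteq> 0"
    "\<And>z. norm z \<le> 1 \<Longrightarrow> norm (poly p z) \<le> norm (poly q z)"
    "\<And>z. norm z < 1 \<Longrightarrow> f z = poly p z / poly q z"
    using blaschke_product_imp_rational[OF assms(2)] by blast
  let ?p = "p + smult (- a) q" and ?q = "q + smult (cnj (- a)) p"
  show ?thesis
  proof (rule rational_imp_blaschke_product[where \<kappa> = 1])
    show "reciprocal_pair d ?p ?q"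
      by (intro reciprocal_pair_add reciprocal_pair_smult pq(1) reciprocal_pair_swap[OF pq(1)])
    show "poly ?q z \<noteq> 0" if "norm z \<le> 1" for z
    proof
      assume "poly ?q z = 0"
      then have "poly q z = cnj a * poly p z" by simp
      then have "norm (poly q z) = norm a * norm (poly p z)"
        by (simp only: norm_mult complex_mod_cnj)
      also have "\<dots> \<le> norm a * norm (poly q z)"
        by (intro mult_left_mono pq(3) that) auto
      also have "\<dots> < 1 * norm (poly q z)"
        using pq(2)[OF that] assms(1) by (intro mult_strict_right_mono) auto
      finally show False by simp
    qed
    show "disc_aut a (f z) = 1 * (poly ?p z / poly ?q z)" if "norm z < 1" for z
    proof -
      have "poly q z \<noteq> 0" using pq(2) that by simp
      moreover have "f z - a = poly ?p z / poly q z" "1 - cnj a * f z = poly ?q z / poly q z"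
        using \<open>poly q z \<noteq> 0\<close> by (simp_all add: pq(4)[OF that] field_simps)
      ultimately show ?thesis by (simp add: disc_aut_def)
    qed
  qed simp
qed

lemma blaschke_product_cong:
  assumes "\<And>z. norm z < 1 \<Longrightarrow> f z = g z"
  shows "blaschke_product d f \<longleftrightarrow> blaschke_product d g"
  unfolding blaschke_product_def using assms by auto

lemma blaschke_product_disc_aut_iff:
  assumes "norm a < 1" "f ` ball 0 1 \<subseteq> ball 0 1"
  shows "blaschke_product d (\<lambda>z. disc_aut a (f z)) \<longleftrightarrow> blaschke_product d f"
proof
  assume "blaschke_product d (\<lambda>z. disc_aut a (f z))"
  then have "blaschke_product d (\<lambda>z. disc_aut (- a) (disc_aut a (f z)))"
    by (rule blaschke_product_disc_aut[rotated]) (use assms in simp)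
  moreover have "blaschke_product d (\<lambda>z. disc_aut (- a) (disc_aut a (f z))) \<longleftrightarrow> blaschke_product d f"
    by (intro blaschke_product_cong disc_aut_inverse assms less_imp_le self_map_norm_less[OF assms(2)])
  ultimately show "blaschke_product d f" by (rule iffD1[rotated])
qed (rule blaschke_product_disc_aut[OF assms(1)])

lemma blaschke_product_const: "norm c = 1 \<Longrightarrow> blaschke_product 0 (\<lambda>z. c)"
  unfolding blaschke_product_mset by (intro exI[of _ c] exI[of _ "{#}"]) simp

text \<open>
  For the direction from left to right, the product vanishes at \<open>a\<close>, hence \<open>a\<close> is one of its zeros;
  cancelling that factor determines \<open>H\<close> away from \<open>a\<close>, and continuity does so at \<open>a\<close>.
\<close>

lemma blaschke_product_times_disc_aut:
  assumes "norm a < 1" and H: "continuous_on (ball 0 1) H"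
  shows "blaschke_product (Suc d) (\<lambda>z. disc_aut a z * H z) \<longleftrightarrow> blaschke_product d H" (is "?L \<longleftrightarrow> ?R")
proof
  assume ?R
  then obtain c A where cA: "norm c = 1" "size A = d" "\<forall>a\<in>#A. norm a < 1"
    and "\<forall>z\<in>ball 0 1. H z = c * (\<Prod>a\<in>#A. disc_aut a z)"
    unfolding blaschke_product_mset by blast
  then show ?L unfolding blaschke_product_mset using assms(1)
    by (intro exI[of _ c] exI[of _ "add_mset a A"]) auto
next
  assume ?L
  then obtain c A where c: "norm c = 1" and A: "size A = Suc d" "\<forall>a\<in>#A. norm a < 1"
    and f: "\<And>z. norm z < 1 \<Longrightarrow> disc_aut a z * H z = c * (\<Prod>a\<in>#A. disc_aut a z)"
    unfolding blaschke_product_mset by auto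
  have "(\<Prod>b\<in>#A. disc_aut b a) = 0"
    using f[OF assms(1)] c by (auto simp: disc_aut_def)
  then obtain b where b: "b \<in># A" "disc_aut b a = 0" by auto
  then have "b = a"
    using one_minus_cnj_mult_neq_0[of b a] A(2) assms(1) by (auto simp: disc_aut_def)
  then obtain A' where A': "A = add_mset a A'" using multi_member_split[OF b(1)] by auto
  let ?K = "\<lambda>z. c * (\<Prod>b\<in>#A'. disc_aut b z)"
  have eq: "H z = ?K z" if "norm z < 1" "z \<noteq> a" for z
    using f[OF that(1)] one_minus_cnj_mult_neq_0[of a z] assms(1) that
    by (auto simp: A' disc_aut_def)
  have "continuous_on (ball 0 1) (\<lambda>z. \<Prod>b\<in>#A'. disc_aut b z)"
    using A(2) unfolding A'
  proof (induction A')
    case (add b A')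
    have "continuous_on (ball 0 1) (disc_aut b)"
      by (rule holomorphic_on_imp_continuous_on, rule disc_aut_holomorphic[of b "\<lambda>z. z"])
         (use add.prems in \<open>auto intro: holomorphic_on_ident\<close>)
    moreover have "continuous_on (ball 0 1) (\<lambda>z. \<Prod>b\<in>#A'. disc_aut b z)"
      by (rule add.IH) (use add.prems in auto)
    ultimately show ?case by (simp add: continuous_on_mult)
  qed simp
  then have "isCont ?K a" "isCont H a"
    using H assms(1) by (auto simp: continuous_on_eq_continuous_at)
  then have lims: "?K \<midarrow>a\<rightarrow> ?K a" "H \<midarrow>a\<rightarrow> H a" by (auto simp: isCont_def)
  have "\<forall>\<^sub>F z in at a. H z = ?K z"
    using eq assms(1) by (auto simp: eventually_at_topological intro!: exI[of _ "ball 0 1"])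
  then have "H \<midarrow>a\<rightarrow> ?K a" using lims(1) by (simp only: tendsto_cong)
  then have "H a = ?K a" using lims(2) tendsto_unique[OF trivial_limit_at] by blast
  then have "\<forall>z\<in>ball 0 1. H z = ?K z" using eq by (metis mem_ball_0)
  then show ?R unfolding blaschke_product_mset using A c A'
    by (intro exI[of _ c] exI[of _ A']) auto
qed

lemma blaschke_product_times_disc_aut_power:
  assumes "norm a < 1" and H: "H holomorphic_on ball 0 1"
  shows "blaschke_product (d + k) (\<lambda>z. disc_aut a z ^ k * H z) \<longleftrightarrow> blaschke_product d H"
proof (induction k)
  case (Suc k)
  have "disc_aut a holomorphic_on ball 0 1"
    using assms(1) disc_aut_holomorphic[of a "\<lambda>z. z" "ball 0 1"] by (auto intro: holomorphic_on_ident)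
  then have "continuous_on (ball 0 1) (\<lambda>z. disc_aut a z ^ k * H z)"
    using H by (intro holomorphic_on_imp_continuous_on holomorphic_intros)
  from blaschke_product_times_disc_aut[OF assms(1) this, of "d + k"] Suc
  show ?case by (simp add: mult.assoc)
qed simp

section \<open>Herglotz sums and the Cowen--Pommerenke inequality\<close>

lemma reciprocal_pair_sum:
  assumes "\<And>i. i \<in> J \<Longrightarrow> reciprocal_pair d (p i) (q i)"
  shows "reciprocal_pair d (\<Sum>i\<in>J. p i) (\<Sum>i\<in>J. q i)"
  using assms
proof (induction J rule: infinite_finite_induct)
  case (insert j J)
  then show ?case using reciprocal_pair_add by simp
qed (auto simp: reciprocal_pair_def)

lemma reciprocal_pair_prod:
  assumes "finite J" "\<And>i. i \<in> J \<Longrightarrow> reciprocal_pair 1 (p i) (q i)"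
  shows "reciprocal_pair (card J) (\<Prod>i\<in>J. p i) (\<Prod>i\<in>J. q i)"
  using assms
proof (induction J rule: finite_induct)
  case empty
  show ?case by (simp add: reciprocal_pair_def)
next
  case (insert j J)
  then have "reciprocal_pair (1 + card J) (p j * (\<Prod>i\<in>J. p i)) (q j * (\<Prod>i\<in>J. q i))"
    by (intro reciprocal_pair_mult) auto
  then show ?case using insert.hyps by simp
qed

lemma smult_sum_right: "smult c (\<Sum>i\<in>J. p i) = (\<Sum>i\<in>J. smult c (p i))"
  by (induction J rule: infinite_finite_induct) (simp_all add: smult_add_right)

lemma cayley_inverse:
  assumes "1 - w \<noteq> 0" shows "cayley w - 1 = w * (cayley w + 1)"
proof -
  have "cayley w * (1 - w) = 1 + w" using assms by (simp add: cayley_def)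
  then show ?thesis by (simp add: algebra_simps)
qed

lemma cayley_divide:
  assumes "b \<noteq> 0" shows "cayley (a / b) = (b + a) / (b - a)"
proof -
  have "1 + a / b = (b + a) / b" "1 - a / b = (b - a) / b"
    using assms by (simp_all add: field_simps)
  then show ?thesis using assms by (simp add: cayley_def)
qed

text \<open>
  Write \<open>D z\<close> for the product of the \<open>\<sigma>\<^sub>j - z\<close> and the Herglotz sum as \<open>N / D\<close>; then
  \<open>H = (N - D) / (N + D)\<close>. Taking conjugate reciprocals multiplies \<open>D\<close> by the unimodular number \<open>s\<close>
  and \<open>N\<close> by \<open>- s\<close>, which expresses that the sum is imaginary on the circle. So \<open>N - D\<close> and \<open>N + D\<close>
  are a reciprocal pair up to the factor \<open>- s\<close>.
\<close>

lemma herglotz_sum_imp_blaschke_product: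
  fixes \<sigma> :: "'i \<Rightarrow> complex"
  assumes fin: "finite J" and inj: "inj_on \<sigma> J" and \<sigma>: "\<And>j. j \<in> J \<Longrightarrow> norm (\<sigma> j) = 1"
    and m: "\<And>j. j \<in> J \<Longrightarrow> 0 < m j"
    and H: "\<And>z. norm z < 1 \<Longrightarrow> H z \<noteq> 1"
    and rep: "\<And>z. norm z < 1 \<Longrightarrow>
       cayley (H z) = \<i> * of_real \<alpha> + (\<Sum>j\<in>J. of_real (m j) * herglotz (\<sigma> j) z)"
  shows "blaschke_product (card J) H"
proof -
  define \<Phi> where "\<Phi> z = \<i> * of_real \<alpha> + (\<Sum>j\<in>J. of_real (m j) * herglotz (\<sigma> j) z)" for z
  define s where "s = (\<Prod>j\<in>J. - cnj (\<sigma> j))"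
  define D where "D = (\<Prod>i\<in>J. [:\<sigma> i, -1:])"
  define T where "T = (\<lambda>j. [:\<sigma> j, 1:] * (\<Prod>i\<in>J - {j}. [:\<sigma> i, -1:]))"
  define N where "N = smult (\<i> * of_real \<alpha>) D + (\<Sum>j\<in>J. smult (of_real (m j)) (T j))"
  have unit: "cnj (\<sigma> j) * \<sigma> j = 1" "\<sigma> j * cnj (\<sigma> j) = 1" "\<sigma> j \<noteq> 0" if "j \<in> J" for j
    using \<sigma>[OF that] by (auto simp: complex_norm_square[symmetric] mult.commute)
  have lin: "reciprocal_pair 1 [:\<sigma> j, -1:] (smult (- cnj (\<sigma> j)) [:\<sigma> j, -1:])" if "j \<in> J" for j
    using unit[OF that] by (auto simp: reciprocal_pair_def algebra_simps)
  have D: "reciprocal_pair (card J) D (smult s D)"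
    unfolding D_def s_def prod_smult[symmetric]
    by (rule reciprocal_pair_prod[OF fin lin])
  have T: "reciprocal_pair (card J) (T j) (smult (- s) (T j))" if "j \<in> J" for j
  proof -
    have 1: "reciprocal_pair 1 [:\<sigma> j, 1:] (smult (cnj (\<sigma> j)) [:\<sigma> j, 1:])"
      using unit[OF that] by (auto simp: reciprocal_pair_def algebra_simps)
    have 2: "reciprocal_pair (card (J - {j})) (\<Prod>i\<in>J - {j}. [:\<sigma> i, -1:]) (\<Prod>i\<in>J - {j}. smult (- cnj (\<sigma> i)) [:\<sigma> i, -1:])"
      by (rule reciprocal_pair_prod) (use fin lin in auto)
    have "s = - cnj (\<sigma> j) * (\<Prod>i\<in>J - {j}. - cnj (\<sigma> i))"
      unfolding s_def using fin that by (rule prod.remove)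
    then have s: "- s = cnj (\<sigma> j) * (\<Prod>i\<in>J - {j}. - cnj (\<sigma> i))" by simp
    have "smult (cnj (\<sigma> j)) [:\<sigma> j, 1:] * (\<Prod>i\<in>J - {j}. smult (- cnj (\<sigma> i)) [:\<sigma> i, -1:]) = smult (- s) (T j)"
      unfolding s T_def prod_smult by (simp only: mult_smult_left mult_smult_right smult_smult mult.commute[of "cnj (\<sigma> j)"])
    moreover have "card J = 1 + card (J - {j})" using fin that by (metis card_Suc_Diff1 plus_1_eq_Suc)
    ultimately show ?thesis
      using reciprocal_pair_mult[OF 1 2] by (simp only: T_def)
  qed
  have "reciprocal_pair (card J) N
     (smult (cnj (\<i> * of_real \<alpha>)) (smult s D) + (\<Sum>j\<in>J. smult (cnj (of_real (m j))) (smult (- s) (T j))))"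
    unfolding N_def by (intro reciprocal_pair_add reciprocal_pair_sum reciprocal_pair_smult D T)
  also have "(\<Sum>j\<in>J. smult (cnj (of_real (m j))) (smult (- s) (T j))) = smult (- s) (\<Sum>j\<in>J. smult (of_real (m j)) (T j))"
    unfolding smult_sum_right by (intro sum.cong) (auto simp: mult.commute)
  also have "smult (cnj (\<i> * of_real \<alpha>)) (smult s D) + \<dots> = smult (- s) N"
    by (simp add: N_def smult_add_right mult.commute)
  finally have N: "reciprocal_pair (card J) N (smult (- s) N)" .
  have "reciprocal_pair (card J) (N + smult (- 1) D) (smult (- s) N + smult (cnj (- 1)) (smult s D))"
    by (intro reciprocal_pair_add reciprocal_pair_smult N D)
  then have pair: "reciprocal_pair (card J) (N - D) (smult (- s) (N + D))"
    by (simp add: smult_add_right)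
  have norm_s: "norm s = 1" unfolding s_def by (simp add: prod_norm[symmetric] \<sigma>)
  then have s0: "s \<noteq> 0" by auto
  have T_poly: "poly (T j) z = (\<sigma> j + z) * (\<Prod>i\<in>J - {j}. \<sigma> i - z)" for j z
    unfolding T_def poly_mult poly_prod by simp
  have D_nz: "poly D z \<noteq> 0" if "z \<notin> \<sigma> ` J" for z
    using that fin by (auto simp: D_def poly_prod)
  have ND: "poly N z = poly D z * \<Phi> z" if "z \<notin> \<sigma> ` J" for z
  proof -
    have "poly (T j) z = poly D z * herglotz (\<sigma> j) z" if "j \<in> J" for j
    proof -
      have "poly D z = (\<sigma> j - z) * (\<Prod>i\<in>J - {j}. \<sigma> i - z)"
        unfolding D_def poly_prod using prod.remove[OF fin that, of "\<lambda>i. \<sigma> i - z"] by simp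
      moreover have "\<sigma> j - z \<noteq> 0" using \<open>z \<notin> \<sigma> ` J\<close> that by auto
      ultimately show ?thesis by (simp add: T_poly herglotz_def)
    qed
    then have "(\<Sum>j\<in>J. of_real (m j) * poly (T j) z) = poly D z * (\<Sum>j\<in>J. of_real (m j) * herglotz (\<sigma> j) z)"
      unfolding sum_distrib_left by (intro sum.cong) (auto simp: mult_ac)
    then show ?thesis by (simp add: N_def \<Phi>_def poly_sum algebra_simps)
  qed
  have Re_ge: "0 \<le> Re (\<Phi> z)" if "norm z \<le> 1" for z
  proof -
    have "0 \<le> m j * Re (herglotz (\<sigma> j) z)" if "j \<in> J" for j
      using m[OF that] \<sigma>[OF that] \<open>norm z \<le> 1\<close> by (simp add: Re_herglotz abs_square_le_1)
    then show ?thesis by (simp add: \<Phi>_def Re_sum sum_nonneg)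
  qed
  \<comment> \<open>Away from the poles \<open>N + D = D * (\<Phi> + 1)\<close> with \<open>Re \<Phi> \<ge> 0\<close>; at a pole only its own term of \<open>N\<close>
      survives, and it is nonzero because the mass is positive.\<close>
  have nz: "poly (N + D) z \<noteq> 0" if "norm z \<le> 1" for z
  proof (cases "z \<in> \<sigma> ` J")
    case False
    have "\<Phi> z + 1 \<noteq> 0" using Re_ge[OF that] by (auto simp: complex_eq_iff)
    moreover have "poly (N + D) z = poly D z * (\<Phi> z + 1)"
      using ND[OF False] by (simp add: algebra_simps)
    ultimately show ?thesis using D_nz[OF False] by simp
  next
    case True
    then obtain j where j: "j \<in> J" "z = \<sigma> j" by auto
    have Dz: "poly D z = 0" using fin j by (auto simp: D_def poly_prod)
    have "poly (T i) z = 0" if "i \<in> J - {j}" for i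
      using fin j that by (auto simp: T_poly)
    then have "(\<Sum>i\<in>J - {j}. of_real (m i) * poly (T i) z) = 0" by simp
    then have "poly (N + D) z = of_real (m j) * poly (T j) z"
      using sum.remove[OF fin j(1), of "\<lambda>i. of_real (m i) * poly (T i) z"] Dz by (simp add: N_def poly_sum)
    moreover have "poly (T j) z \<noteq> 0"
      using fin j unit(3)[OF j(1)] inj by (auto simp: T_poly inj_on_def)
    ultimately show ?thesis using m[OF j(1)] by simp
  qed
  show ?thesis
  proof (rule rational_imp_blaschke_product[OF pair, of "- s"])
    show "poly (smult (- s) (N + D)) z \<noteq> 0" if "norm z \<le> 1" for z
      using nz[OF that] s0 by (simp del: poly_add)
    show "H z = - s * (poly (N - D) z / poly (smult (- s) (N + D)) z)" if z: "norm z < 1" for z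
    proof -
      have nin: "z \<notin> \<sigma> ` J" using \<sigma> z by auto
      have H1: "1 - H z \<noteq> 0" using H[OF z] by simp
      have \<Phi>: "\<Phi> z = cayley (H z)" using rep[OF z] by (simp add: \<Phi>_def)
      have "poly (N - D) z = poly D z * (\<Phi> z - 1)" "poly (N + D) z = poly D z * (\<Phi> z + 1)"
        using ND[OF nin] by (simp_all add: algebra_simps)
      moreover have "\<Phi> z - 1 = H z * (\<Phi> z + 1)"
        unfolding \<Phi> using H1 by (rule cayley_inverse)
      ultimately have "poly (N - D) z = H z * poly (N + D) z"
        by (simp only: mult.left_commute)
      then show ?thesis using s0 nz[of z] z by (simp del: poly_add poly_diff)
    qed
  qed (use norm_s in simp)
qed

lemma poly_eq_smult_prod_roots:
  fixes R :: "complex poly"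
  assumes "finite J" "inj_on \<sigma> J" "degree R \<le> card J" "\<And>j. j \<in> J \<Longrightarrow> poly R (\<sigma> j) = 0"
  shows "\<exists>c. R = smult c (\<Prod>j\<in>J. [:- \<sigma> j, 1:])"
  using assms
proof (induction J arbitrary: R rule: finite_induct)
  case empty
  then obtain c where "R = [:c:]" by (auto elim: degree_eq_zeroE)
  then show ?case by simp
next
  case (insert j J)
  obtain R' where R': "R = [:- \<sigma> j, 1:] * R'"
    using insert.prems(3)[of j] by (auto simp: poly_eq_0_iff_dvd)
  have "poly R' (\<sigma> i) = 0" if "i \<in> J" for i
  proof -
    have "\<sigma> i \<noteq> \<sigma> j" using insert.prems(1) insert.hyps that by (auto simp: inj_on_def)
    then show ?thesis using insert.prems(3)[of i] that by (auto simp: R')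
  qed
  moreover have "degree R' \<le> card J"
  proof (cases "R' = 0")
    case False
    then show ?thesis using insert.prems(2) insert.hyps
      by (simp add: R' degree_mult_eq del: mult_pCons_left)
  qed simp
  ultimately obtain c where "R' = smult c (\<Prod>j\<in>J. [:- \<sigma> j, 1:])"
    using insert.IH[of R'] insert.prems(1) by auto
  then show ?case using insert.hyps
    by (intro exI[of _ c]) (simp add: R' del: mult_pCons_left)
qed

text \<open>
  With \<open>H = p / q\<close> the function \<open>(1 + H) / (1 - H)\<close> equals \<open>(q + p) / (q - p)\<close>. The denominator has
  degree at most \<open>card J\<close> and vanishes at each \<open>\<sigma>\<^sub>j\<close>, so its zeros are known and simple, and the
  expansion is the partial fraction decomposition. It holds at every point that is not a pole; on the
  unit circle \<open>|p| = |q|\<close> makes the real part vanish.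
\<close>

lemma blaschke_product_imp_herglotz_sum:
  fixes \<sigma> :: "'i \<Rightarrow> complex"
  assumes fin: "finite J" and inj: "inj_on \<sigma> J" and \<sigma>: "\<And>j. j \<in> J \<Longrightarrow> norm (\<sigma> j) = 1"
    and bl: "blaschke_product (card J) H" and H0: "H 0 \<noteq> 1"
    and lim: "\<And>j. j \<in> J \<Longrightarrow> ((\<lambda>r. H (of_real r * \<sigma> j)) \<longlongrightarrow> 1) (at_left 1)"
  shows "\<exists>K m. (\<forall>z. norm z < 1 \<longrightarrow> cayley (H z) = K + (\<Sum>j\<in>J. m j * herglotz (\<sigma> j) z)) \<and>
     (\<forall>\<xi>. norm \<xi> = 1 \<longrightarrow> \<xi> \<notin> \<sigma> ` J \<longrightarrow> Re (K + (\<Sum>j\<in>J. m j * herglotz (\<sigma> j) \<xi>)) = 0)"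
proof -
  obtain p q where pq: "reciprocal_pair (card J) p q"
    and q: "\<And>z. norm z \<le> 1 \<Longrightarrow> poly q z \<noteq> 0"
    and "\<And>z. norm z \<le> 1 \<Longrightarrow> norm (poly p z) \<le> norm (poly q z)"
    and H: "\<And>z. norm z < 1 \<Longrightarrow> H z = poly p z / poly q z"
    using blaschke_product_imp_rational[OF bl] by blast
  define P where "P = (\<Prod>j\<in>J. [:- \<sigma> j, 1:])"
  define Q where "Q = (\<lambda>j. \<Prod>i\<in>J - {j}. [:- \<sigma> i, 1:])"
  have p_eq_q: "poly p (\<sigma> j) = poly q (\<sigma> j)" if j: "j \<in> J" for j
  proof -
    have q1: "poly q (\<sigma> j) \<noteq> 0" using q \<sigma>[OF j] by simp
    have "((\<lambda>r. poly p (of_real r * \<sigma> j) / poly q (of_real r * \<sigma> j)) \<longlongrightarrow> poly p (\<sigma> j) / poly q (\<sigma> j)) (at_left 1)"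
      by (intro tendsto_divide isCont_tendsto_compose[OF poly_isCont radial_tendsto] q1)
    moreover have "\<forall>\<^sub>F r in at_left 1. poly p (of_real r * \<sigma> j) / poly q (of_real r * \<sigma> j) = H (of_real r * \<sigma> j)"
      using eventually_radial_in_disc[OF \<sigma>[OF j]] by eventually_elim (simp add: H)
    ultimately have "((\<lambda>r. H (of_real r * \<sigma> j)) \<longlongrightarrow> poly p (\<sigma> j) / poly q (\<sigma> j)) (at_left 1)"
      by (rule Lim_transform_eventually)
    then have "poly p (\<sigma> j) / poly q (\<sigma> j) = 1"
      using lim[OF j] tendsto_unique[OF trivial_limit_at_left_real] by blast
    then show ?thesis using q1 by simp
  qed
  have deg: "degree p \<le> card J" "degree q \<le> card J" using pq by (auto simp: reciprocal_pair_def)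
  obtain c where c: "q - p = smult c P"
    using poly_eq_smult_prod_roots[OF fin inj, of "q - p"] p_eq_q deg
    unfolding P_def by (auto intro: degree_diff_le)
  have c0: "c \<noteq> 0"
  proof
    assume "c = 0"
    then have "q = p" using c by simp
    then have "H 0 = 1" using H[of 0] q[of 0] by simp
    then show False using H0 by simp
  qed
  \<comment> \<open>Lagrange interpolation of the numerator at the nodes \<open>\<sigma> j\<close>, up to a multiple of the node
      polynomial.\<close>
  define e where "e = (\<lambda>j. poly (q + p) (\<sigma> j) / poly (Q j) (\<sigma> j))"
  have Q_nz: "poly (Q j) (\<sigma> j) \<noteq> 0" if "j \<in> J" for j
    using that fin inj by (auto simp: Q_def poly_prod inj_on_def)
  have Q_z: "poly (Q i) (\<sigma> j) = 0" if "j \<in> J" "i \<in> J - {j}" for i j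
    using that fin by (auto simp: Q_def poly_prod)
  have "\<exists>C. (q + p) - (\<Sum>j\<in>J. smult (e j) (Q j)) = smult C P"
    unfolding P_def
  proof (rule poly_eq_smult_prod_roots[OF fin inj])
    have "degree (Q j) \<le> card J" for j
    proof -
      have "degree (Q j) \<le> (\<Sum>i\<in>J - {j}. 1)"
        unfolding Q_def using degree_prod_sum_le[of "J - {j}" "\<lambda>i. [:- \<sigma> i, 1:]"] fin by simp
      also have "\<dots> \<le> card J" using fin by (simp add: card_mono)
      finally show ?thesis .
    qed
    then have "degree (\<Sum>j\<in>J. smult (e j) (Q j)) \<le> card J"
      by (intro degree_sum_le fin order_trans[OF degree_smult_le])
    then show "degree ((q + p) - (\<Sum>j\<in>J. smult (e j) (Q j))) \<le> card J"
      using deg by (intro degree_diff_le degree_add_le)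
    fix j assume j: "j \<in> J"
    have "(\<Sum>i\<in>J. e i * poly (Q i) (\<sigma> j)) = e j * poly (Q j) (\<sigma> j)"
      using Q_z[OF j] by (subst sum.remove[OF fin j]) simp
    then show "poly ((q + p) - (\<Sum>j\<in>J. smult (e j) (Q j))) (\<sigma> j) = 0"
      using Q_nz[OF j] by (simp add: poly_sum e_def)
  qed
  then obtain C where C: "(q + p) - (\<Sum>j\<in>J. smult (e j) (Q j)) = smult C P" by blast
  \<comment> \<open>The kernel satisfies \<open>1 + herglotz \<tau> z = 2 * \<tau> / (\<tau> - z)\<close>, which turns a simple fraction with
      residue \<open>e j / c\<close> into \<open>m j\<close> times a kernel and moves a copy of \<open>m j\<close> into the constant.\<close>
  define m where "m = (\<lambda>j. - e j / (2 * c * \<sigma> j))"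
  define K where "K = C / c + (\<Sum>j\<in>J. m j)"
  have rep: "(poly q z + poly p z) / (poly q z - poly p z) = K + (\<Sum>j\<in>J. m j * herglotz (\<sigma> j) z)"
    if nin: "z \<notin> \<sigma> ` J" for z
  proof -
    have P0: "poly P z \<noteq> 0" using nin fin by (auto simp: P_def poly_prod)
    have "e j * poly (Q j) z / (c * poly P z) = m j + m j * herglotz (\<sigma> j) z" if j: "j \<in> J" for j
    proof -
      have 1: "poly P z = (z - \<sigma> j) * poly (Q j) z"
        unfolding P_def Q_def poly_prod using prod.remove[OF fin j, of "\<lambda>i. z - \<sigma> i"] by simp
      have "\<sigma> j \<noteq> 0" "\<sigma> j - z \<noteq> 0" using \<sigma>[OF j] nin j by auto
      moreover have "poly (Q j) z \<noteq> 0" using P0 1 by auto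
      ultimately have "e j * poly (Q j) z / (c * poly P z) = e j / (c * (z - \<sigma> j))" by (simp add: 1)
      moreover have "m j + m j * herglotz (\<sigma> j) z = e j / (c * (z - \<sigma> j))"
      proof -
        have "m j + m j * herglotz (\<sigma> j) z = m j * (2 * \<sigma> j / (\<sigma> j - z))"
          using \<open>\<sigma> j - z \<noteq> 0\<close> by (simp add: herglotz_def field_simps)
        also have "\<dots> = - e j / (c * (\<sigma> j - z))" using \<open>\<sigma> j \<noteq> 0\<close> by (simp add: m_def)
        also have "\<dots> = e j / (c * (z - \<sigma> j))" by (metis minus_diff_eq minus_divide_divide mult_minus_right)
        finally show ?thesis .
      qed
      ultimately show ?thesis by simp
    qed
    then have "(\<Sum>j\<in>J. e j * poly (Q j) z / (c * poly P z)) = (\<Sum>j\<in>J. m j + m j * herglotz (\<sigma> j) z)"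
      by (intro sum.cong) auto
    then have 2: "(\<Sum>j\<in>J. e j * poly (Q j) z) / (c * poly P z) = (\<Sum>j\<in>J. m j) + (\<Sum>j\<in>J. m j * herglotz (\<sigma> j) z)"
      by (simp add: sum_divide_distrib sum.distrib)
    have "poly q z + poly p z = poly ((q + p) - (\<Sum>j\<in>J. smult (e j) (Q j))) z + (\<Sum>j\<in>J. e j * poly (Q j) z)"
      by (simp add: poly_sum)
    also have "\<dots> = C * poly P z + (\<Sum>j\<in>J. e j * poly (Q j) z)" unfolding C by simp
    finally have 3: "poly q z + poly p z = C * poly P z + (\<Sum>j\<in>J. e j * poly (Q j) z)" .
    have "poly q z - poly p z = poly (q - p) z" by simp
    also have "\<dots> = c * poly P z" unfolding c by simp
    finally show ?thesis using c0 P0 2 unfolding 3 by (simp add: K_def add_divide_distrib)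
  qed
  have "cayley (H z) = K + (\<Sum>j\<in>J. m j * herglotz (\<sigma> j) z)" if z: "norm z < 1" for z
  proof -
    have "z \<notin> \<sigma> ` J" using \<sigma> z by auto
    moreover have "cayley (H z) = (poly q z + poly p z) / (poly q z - poly p z)"
      using q[of z] z by (simp add: H cayley_divide)
    ultimately show ?thesis using rep by simp
  qed
  moreover have "Re (K + (\<Sum>j\<in>J. m j * herglotz (\<sigma> j) \<xi>)) = 0" if \<xi>: "norm \<xi> = 1" "\<xi> \<notin> \<sigma> ` J" for \<xi>
  proof -
    have "\<xi> \<noteq> 0" using \<xi> by auto
    then have "cnj \<xi> \<noteq> 0" "1 / cnj \<xi> = \<xi>"
      using \<xi>(1) by (auto simp: divide_eq_eq complex_norm_square[symmetric])
    then have "poly q \<xi> = \<xi> ^ card J * cnj (poly p \<xi>)"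
      using pq \<open>\<xi> \<noteq> 0\<close> by (simp add: reciprocal_pair_def)
    then have n: "norm (poly p \<xi>) = norm (poly q \<xi>)" by (simp add: norm_mult norm_power \<xi>)
    have q1: "poly q \<xi> \<noteq> 0" using q \<xi> by simp
    have "(poly q \<xi> + poly p \<xi>) / (poly q \<xi> - poly p \<xi>) = cayley (poly p \<xi> / poly q \<xi>)"
      using q1 by (simp add: cayley_divide)
    moreover have "Re (cayley (poly p \<xi> / poly q \<xi>)) = 0"
      using q1 n by (simp add: Re_cayley norm_divide)
    ultimately show ?thesis using rep[OF \<xi>(2)] by simp
  qed
  ultimately show ?thesis by blast
qed

text \<open>There are more roots of unity of order \<open>card A + 1\<close> than elements of \<open>A\<close>.\<close>

lemma exists_unit_avoiding:
  assumes "finite A"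
  obtains \<xi> :: complex where "norm \<xi> = 1" "\<xi> \<notin> A"
proof -
  define n where "n = Suc (card A)"
  have "card {z :: complex. z ^ n = 1} = n" by (rule card_roots_unity_eq) (simp add: n_def)
  then have "\<not> {z :: complex. z ^ n = 1} \<subseteq> A"
    using card_mono[OF assms, of "{z. z ^ n = 1}"] by (auto simp: n_def)
  then obtain \<xi> where \<xi>: "\<xi> ^ n = 1" "\<xi> \<notin> A" by auto
  have "norm \<xi> = 1" using \<xi>(1) power_eq_imp_eq_norm[of \<xi> n 1] by (simp add: n_def)
  then show ?thesis using \<xi> that by blast
qed

text \<open>
  The number \<open>b j\<close> is the dilation coefficient of \<open>H\<close> at \<open>\<sigma> j\<close>, where \<open>H\<close> has boundary value 1. For
  \<open>z0 = 0\<close> the Herglotz factors are 1 and this is the classical form of the inequality; the form at an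
  arbitrary \<open>z0\<close> saves moving \<open>z0\<close> to the origin.
\<close>

lemma cowen_pommerenke:
  fixes \<sigma> :: "'i \<Rightarrow> complex"
  assumes holo: "H holomorphic_on ball 0 1" and maps: "H ` ball 0 1 \<subseteq> ball 0 1"
    and fin: "finite J" and inj: "inj_on \<sigma> J" and \<sigma>: "\<And>j. j \<in> J \<Longrightarrow> norm (\<sigma> j) = 1"
    and lim: "\<And>j. j \<in> J \<Longrightarrow> ((\<lambda>r. H (of_real r * \<sigma> j)) \<longlongrightarrow> 1) (at_left 1)"
    and rate: "\<And>j. j \<in> J \<Longrightarrow>
       ((\<lambda>r. (1 - (norm (H (of_real r * \<sigma> j)))\<^sup>2) / (1 - r\<^sup>2)) \<longlongrightarrow> b j) (at_left 1)"
    and z0: "norm z0 < 1"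
  shows "(\<Sum>j\<in>J. 1 / b j * Re (herglotz (\<sigma> j) z0)) \<le> Re (cayley (H z0))"
    and "(\<Sum>j\<in>J. 1 / b j * Re (herglotz (\<sigma> j) z0)) = Re (cayley (H z0)) \<longleftrightarrow> blaschke_product (card J) H"
proof -
  let ?F = "\<lambda>z. cayley (H z)"
  let ?S = "\<lambda>z. \<Sum>j\<in>J. of_real (1 / b j) * herglotz (\<sigma> j) z"
  have lt: "norm (H z) < 1" if "norm z < 1" for z
    using self_map_norm_less[OF maps that] .
  have neq: "H z \<noteq> 1" if "norm z < 1" for z using lt[OF that] by auto
  have F_holo: "?F holomorphic_on ball 0 1"
    unfolding cayley_def using neq by (intro holomorphic_intros holo) auto
  have F_ge: "0 \<le> Re (?F z)" if "norm z < 1" for z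
    using lt[OF that] by (simp add: Re_cayley abs_square_le_1)
  have b: "0 < b j" if "j \<in> J" for j
    by (rule julia_herglotz(1)[OF holo maps \<sigma>[OF that] lim[OF that] rate[OF that]])
  have jul: "1 / b j * Re (herglotz (\<sigma> j) z) \<le> Re (?F z)" if "j \<in> J" "norm z < 1" for j z
    by (rule julia_herglotz(2)[OF holo maps \<sigma> lim rate]) (use that in auto)
  have ineq: "(\<Sum>j\<in>J. 1 / b j * Re (herglotz (\<sigma> j) z)) \<le> Re (?F z)" if "norm z < 1" for z
    by (rule herglotz_atoms_add[OF fin F_holo inj \<sigma> F_ge jul that])
  then show "(\<Sum>j\<in>J. 1 / b j * Re (herglotz (\<sigma> j) z0)) \<le> Re (cayley (H z0))" using z0 .
  have Re_S: "Re (?S z) = (\<Sum>j\<in>J. 1 / b j * Re (herglotz (\<sigma> j) z))" for z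
    by (simp add: Re_sum Re_divide_of_real)
  show "(\<Sum>j\<in>J. 1 / b j * Re (herglotz (\<sigma> j) z0)) = Re (cayley (H z0)) \<longleftrightarrow> blaschke_product (card J) H"
  proof
    assume eq: "(\<Sum>j\<in>J. 1 / b j * Re (herglotz (\<sigma> j) z0)) = Re (cayley (H z0))"
    have W_holo: "(\<lambda>z. ?F z - ?S z) holomorphic_on ball 0 1"
      by (intro holomorphic_intros F_holo herglotz_holomorphic \<sigma>)
    have W_ge: "0 \<le> Re (?F z - ?S z)" if "norm z < 1" for z
      unfolding minus_complex.sel Re_S using ineq[OF that] by simp
    have "Re (?F z0 - ?S z0) = 0" unfolding minus_complex.sel Re_S using eq by simp
    then obtain \<alpha> :: real where \<alpha>: "\<And>z. norm z < 1 \<Longrightarrow> ?F z - ?S z = \<i> * of_real \<alpha>"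
      using zero_real_part_constant[OF W_holo W_ge z0] by blast
    show "blaschke_product (card J) H"
    proof (rule herglotz_sum_imp_blaschke_product[OF fin inj \<sigma>])
      show "0 < 1 / b j" if "j \<in> J" for j using b[OF that] by simp
      show "?F z = \<i> * of_real \<alpha> + ?S z" if "norm z < 1" for z
        using \<alpha>[OF that] by (simp add: algebra_simps)
    qed (use neq in auto)
  next
    assume bl: "blaschke_product (card J) H"
    obtain K m where rep: "\<And>z. norm z < 1 \<Longrightarrow> ?F z = K + (\<Sum>j\<in>J. m j * herglotz (\<sigma> j) z)"
      and bdry: "\<And>\<xi>. norm \<xi> = 1 \<Longrightarrow> \<xi> \<notin> \<sigma> ` J \<Longrightarrow> Re (K + (\<Sum>j\<in>J. m j * herglotz (\<sigma> j) \<xi>)) = 0"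
      using blaschke_product_imp_herglotz_sum[OF fin inj \<sigma> bl neq[of 0] lim] by auto
    \<comment> \<open>Multiplied by \<open>1 - r\<close>, the real part of \<open>F\<close> at \<open>r * \<sigma> j\<close> tends to \<open>2 * Re (m j)\<close>. Julia's
        lemma gives \<open>Re (m j) \<ge> 1 / b j\<close>, and the limit of the dilation quotient gives
        \<open>Re (m j) = b j * |m j|\<^sup>2\<close>; together they leave only \<open>m j = 1 / b j\<close>.\<close>
    have m: "m j = of_real (1 / b j)" if j: "j \<in> J" for j
    proof -
      let ?z = "\<lambda>r. of_real r * \<sigma> j"
      have ev: "\<forall>\<^sub>F r in at_left 1. norm (?z r) < 1" by (rule eventually_radial_in_disc[OF \<sigma>[OF j]])
      have inj': "\<sigma> j \<noteq> \<sigma> i" if "i \<in> J - {j}" for i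
        using inj j that by (auto simp: inj_on_def)
      have "((\<lambda>r. of_real (1 - r) * K + (m j * (of_real (1 - r) * herglotz (\<sigma> j) (?z r))
            + (\<Sum>i\<in>J - {j}. m i * (of_real (1 - r) * herglotz (\<sigma> i) (?z r)))))
          \<longlongrightarrow> of_real (1 - 1) * K + (m j * 2 + (\<Sum>i\<in>J - {j}. m i * 0))) (at_left 1)"
        by (intro tendsto_intros herglotz_radial_pole \<sigma>[OF j] herglotz_radial_regular inj')
      moreover have "\<forall>\<^sub>F r in at_left 1. of_real (1 - r) * K + (m j * (of_real (1 - r) * herglotz (\<sigma> j) (?z r))
            + (\<Sum>i\<in>J - {j}. m i * (of_real (1 - r) * herglotz (\<sigma> i) (?z r)))) = of_real (1 - r) * ?F (?z r)"
        using ev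
      proof eventually_elim
        case (elim r)
        show ?case
          unfolding rep[OF elim] sum.remove[OF fin j]
          by (simp add: distrib_left sum_distrib_left mult.left_commute)
      qed
      ultimately have lim_F: "((\<lambda>r. of_real (1 - r) * ?F (?z r)) \<longlongrightarrow> 2 * m j) (at_left 1)"
        by (auto intro: Lim_transform_eventually simp: mult.commute)
      have "((\<lambda>r. (1 - r) * Re (?F (?z r))) \<longlongrightarrow> Re (2 * m j)) (at_left 1)"
        using tendsto_Re[OF lim_F] by simp
      moreover have "((\<lambda>r. 1 / b j * Re (of_real (1 - r) * herglotz (\<sigma> j) (?z r))) \<longlongrightarrow> 1 / b j * Re 2) (at_left 1)"
        by (intro tendsto_intros herglotz_radial_pole \<sigma>[OF j])
      moreover have "\<forall>\<^sub>F r in at_left 1. 1 / b j * Re (of_real (1 - r) * herglotz (\<sigma> j) (?z r)) \<le> (1 - r) * Re (?F (?z r))"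
        using ev eventually_radial
      proof eventually_elim
        case (elim r)
        show ?case using mult_left_mono[OF jul[OF j elim(1)], of "1 - r"] elim by (simp add: mult_ac)
      qed
      ultimately have "1 / b j * Re 2 \<le> Re (2 * m j)"
        by (intro tendsto_le[OF trivial_limit_at_left_real])
      then have m_ge: "1 / b j \<le> Re (m j)" by simp
      have "((\<lambda>r. of_real (1 - r) * ?F (?z r) + of_real (1 - r)) \<longlongrightarrow> 2 * m j + of_real (1 - 1)) (at_left 1)"
        by (intro tendsto_add[OF lim_F] tendsto_intros)
      note sq = tendsto_power[OF tendsto_norm[OF this], of 2]
      have one_plus: "((\<lambda>r. 1 + r) \<longlongrightarrow> 1 + (1 :: real)) (at_left 1)"
        by (intro tendsto_intros)
      have "((\<lambda>r. (1 - (norm (H (?z r)))\<^sup>2) / (1 - r\<^sup>2) * ((1 + r) * (norm (of_real (1 - r) * ?F (?z r) + of_real (1 - r)))\<^sup>2 / 4))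
          \<longlongrightarrow> b j * ((1 + 1) * (norm (2 * m j + of_real (1 - 1)))\<^sup>2 / 4)) (at_left 1)"
        by (rule tendsto_mult[OF rate[OF j] tendsto_divide[OF tendsto_mult[OF one_plus sq] tendsto_const]]) simp
      moreover have "\<forall>\<^sub>F r in at_left 1. (1 - (norm (H (?z r)))\<^sup>2) / (1 - r\<^sup>2) * ((1 + r) * (norm (of_real (1 - r) * ?F (?z r) + of_real (1 - r)))\<^sup>2 / 4)
          = Re (of_real (1 - r) * ?F (?z r))"
        using ev eventually_radial
      proof eventually_elim
        case (elim r)
        \<comment> \<open>Since \<open>F + 1 = 2 / (1 - H)\<close>, the factor \<open>|1 - H|\<^sup>2\<close> in the denominator of \<open>Re F\<close> is
            expressed by \<open>F\<close> itself.\<close>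
        have H1: "1 - H (?z r) \<noteq> 0" using neq[OF elim(1)] by simp
        have "?F (?z r) + 1 = 2 / (1 - H (?z r))" using H1 by (simp add: cayley_def field_simps)
        moreover have "of_real (1 - r) * ?F (?z r) + of_real (1 - r) = of_real (1 - r) * (?F (?z r) + 1)"
          by (simp only: distrib_left mult_1_right)
        ultimately have "norm (of_real (1 - r) * ?F (?z r) + of_real (1 - r)) = (1 - r) * (2 / norm (1 - H (?z r)))"
          using elim by (simp only: norm_mult norm_divide norm_of_real) simp
        moreover have "1 - r\<^sup>2 = (1 - r) * (1 + r)" by (simp add: power2_eq_square algebra_simps)
        moreover have "1 - r \<noteq> 0" "1 + r \<noteq> 0" using elim by auto
        moreover have "A / (u * v) * (v * (u * (2 / d))\<^sup>2 / 4) = u * (A / d\<^sup>2)"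
          if "u \<noteq> 0" "v \<noteq> 0" "d \<noteq> 0" for A u v d :: real
          using that by (simp add: power2_eq_square)
        moreover have "norm (1 - H (?z r)) \<noteq> 0" using H1 by simp
        ultimately have "(1 - (norm (H (?z r)))\<^sup>2) / (1 - r\<^sup>2) * ((1 + r) * (norm (of_real (1 - r) * ?F (?z r) + of_real (1 - r)))\<^sup>2 / 4)
            = (1 - r) * ((1 - (norm (H (?z r)))\<^sup>2) / (norm (1 - H (?z r)))\<^sup>2)"
          by (simp only:)
        then show ?case by (simp add: Re_cayley)
      qed
      ultimately have "((\<lambda>r. Re (of_real (1 - r) * ?F (?z r))) \<longlongrightarrow> b j * ((1 + 1) * (norm (2 * m j + of_real (1 - 1)))\<^sup>2 / 4)) (at_left 1)"
        by (rule Lim_transform_eventually)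
      with tendsto_Re[OF lim_F] have "Re (2 * m j) = b j * ((1 + 1) * (norm (2 * m j + of_real (1 - 1)))\<^sup>2 / 4)"
        by (rule tendsto_unique[OF trivial_limit_at_left_real])
      then have m_eq: "Re (m j) = b j * (norm (m j))\<^sup>2"
        by (simp add: norm_mult power_mult_distrib)
      have "(norm (m j))\<^sup>2 = 1 / b j * Re (m j)" using m_eq b[OF j] by simp
      also have "\<dots> \<le> Re (m j) * Re (m j)"
        using m_ge b[OF j] by (intro mult_right_mono) (auto intro: order_trans[of 0 "1 / b j"])
      finally have "Im (m j) = 0" by (simp add: cmod_power2 power2_eq_square[of "Re (m j)"])
      then have "Re (m j) = b j * (Re (m j))\<^sup>2" using m_eq by (simp add: cmod_power2)
      moreover have "Re (m j) \<noteq> 0" using m_ge b[OF j] by (metis not_le zero_less_divide_1_iff)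
      ultimately have "Re (m j) = 1 / b j" using b[OF j] by (simp add: power2_eq_square field_simps)
      then show ?thesis using \<open>Im (m j) = 0\<close> by (simp add: complex_eq_iff)
    qed
    have S_eq: "(\<Sum>j\<in>J. m j * herglotz (\<sigma> j) z) = ?S z" for z
      by (intro sum.cong) (auto simp: m)
    obtain \<xi> where \<xi>: "norm \<xi> = 1" "\<xi> \<notin> \<sigma> ` J"
      using exists_unit_avoiding[of "\<sigma> ` J"] fin by blast
    have "Re (?S \<xi>) = 0"
      unfolding Re_S using \<xi> by (intro sum.neutral) (simp add: Re_herglotz \<sigma>)
    then have "Re K = 0" using bdry[OF \<xi>] unfolding S_eq plus_complex.sel by simp
    then have "Re (?F z0) = Re (?S z0)" using rep[OF z0] unfolding S_eq by simp
    then show "(\<Sum>j\<in>J. 1 / b j * Re (herglotz (\<sigma> j) z0)) = Re (cayley (H z0))"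
      unfolding Re_S by simp
  qed
qed

section \<open>Dividing out the zero at the fixed point\<close>

text \<open>
  One factor is split off at a time. Leibniz's rule gives the value of the cofactor, and this value is
  also what shows that the cofactor vanishes as long as the next derivative of \<open>g\<close> does.
\<close>

lemma holomorphic_factor_power:
  assumes "g holomorphic_on S" "open S" "a \<in> S" "\<And>i. i < k \<Longrightarrow> (deriv ^^ i) g a = 0"
  shows "\<exists>h. h holomorphic_on S \<and> (\<forall>z\<in>S. g z = (z - a) ^ k * h z) \<and> h a = (deriv ^^ k) g a / fact k"
proof -
  have deriv_at: "(deriv ^^ k) g a = fact k * h a"
    if h: "h holomorphic_on S" and eq: "\<forall>z\<in>S. g z = (z - a) ^ k * h z" for h k
  proof -
    have pow: "(\<lambda>z. (z - a) ^ k) holomorphic_on S" by (intro holomorphic_intros)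
    have "(deriv ^^ k) g a = (deriv ^^ k) (\<lambda>z. (z - a) ^ k * h z) a"
      by (rule higher_deriv_transform_within_open[of _ S]) (use assms h eq pow in \<open>auto intro!: holomorphic_intros\<close>)
    also have "\<dots> = (\<Sum>i = 0..k. of_nat (k choose i) * (deriv ^^ i) (\<lambda>z. (z - a) ^ k) a * (deriv ^^ (k - i)) h a)"
      by (rule higher_deriv_mult[OF pow h assms(2,3)])
    also have "\<dots> = (\<Sum>i \<in> {k}. of_nat (k choose i) * (deriv ^^ i) (\<lambda>z. (z - a) ^ k) a * (deriv ^^ (k - i)) h a)"
      by (rule sum.mono_neutral_right) (auto simp: higher_deriv_power)
    also have "\<dots> = fact k * h a"
      by (simp add: higher_deriv_power pochhammer_fact[symmetric])
    finally show ?thesis .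
  qed
  have "\<exists>h. h holomorphic_on S \<and> (\<forall>z\<in>S. g z = (z - a) ^ k * h z)"
    using assms(4)
  proof (induction k)
    case 0
    then show ?case using assms(1) by auto
  next
    case (Suc k)
    then obtain h where h: "h holomorphic_on S" "\<forall>z\<in>S. g z = (z - a) ^ k * h z" by auto
    have "h a = 0" using deriv_at[OF h] Suc.prems[of k] by simp
    define h' where "h' = (\<lambda>z. if z = a then deriv h a else (h z - h a) / (z - a))"
    have "h' holomorphic_on S" unfolding h'_def by (rule pole_lemma_open[OF h(1) assms(2)])
    moreover have "g z = (z - a) ^ Suc k * h' z" if "z \<in> S" for z
      using h(2) that \<open>h a = 0\<close> by (auto simp: h'_def)
    ultimately show ?case by blast
  qed
  then obtain h where h: "h holomorphic_on S" "\<forall>z\<in>S. g z = (z - a) ^ k * h z" by blast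
  moreover have "h a = (deriv ^^ k) g a / fact k" using deriv_at[OF h] by simp
  ultimately show ?thesis by blast
qed

text \<open>
  Division by \<open>T ^ k\<close> costs nothing in the maximum principle, because \<open>|T|\<close> tends to 1 uniformly at
  the unit circle. The number \<open>\<rho> r\<close> is a lower bound for \<open>|T|\<^sup>2\<close> on the circle of radius \<open>r\<close>.
\<close>

lemma norm_le_1_of_disc_aut_power:
  assumes a: "norm a < 1" and H: "H holomorphic_on ball 0 1"
    and le: "\<And>z. norm z < 1 \<Longrightarrow> norm (disc_aut a z ^ k * H z) \<le> 1"
    and w: "norm w < 1"
  shows "norm (H w) \<le> 1"
proof -
  define \<rho> where "\<rho> = (\<lambda>r. 1 - (1 - (norm a)\<^sup>2) * (1 - r\<^sup>2) / (1 - norm a)\<^sup>2)"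
  have \<rho>: "(\<rho> \<longlongrightarrow> 1 - (1 - (norm a)\<^sup>2) * (1 - 1\<^sup>2) / (1 - norm a)\<^sup>2) (at_left 1)"
    unfolding \<rho>_def using a by (intro tendsto_intros) auto
  then have lim: "((\<lambda>r. sqrt (1 / \<rho> r ^ k)) \<longlongrightarrow> sqrt (1 / 1 ^ k)) (at_left 1)"
    by (intro tendsto_intros) auto
  have "\<forall>\<^sub>F r in at_left 1. 0 < \<rho> r" using \<rho> by (intro order_tendstoD) auto
  moreover have "\<forall>\<^sub>F r in at_left 1. norm w < r \<and> r < 1"
    using eventually_at_left_real[OF w] by (simp add: eventually_mono)
  ultimately have "\<forall>\<^sub>F r in at_left 1. norm (H w) \<le> sqrt (1 / \<rho> r ^ k)"
  proof eventually_elim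
    case (elim r)
    then have r: "0 < r" "r < 1" "norm w < r" using norm_ge_zero[of w] by linarith+
    show ?case
    proof (rule maximum_modulus_frontier[of H "ball 0 r"])
      show "H holomorphic_on interior (ball 0 r)" using H r by (auto intro: holomorphic_on_subset)
      show "continuous_on (closure (ball 0 r)) H"
        using r by (intro continuous_on_subset[OF holomorphic_on_imp_continuous_on[OF H]]) auto
      show "norm (H z) \<le> sqrt (1 / \<rho> r ^ k)" if "z \<in> frontier (ball 0 r)" for z
      proof -
        have z: "norm z = r" using that r by (simp add: frontier_ball)
        then have z1: "norm z < 1" using r by simp
        have "1 - norm a \<le> norm (1 - cnj a * z)"
        proof -
          have "1 - norm (cnj a * z) \<le> norm (1 - cnj a * z)"
            using norm_triangle_ineq2[of 1 "cnj a * z"] by simp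
          moreover have "norm (cnj a * z) \<le> norm a * 1"
            unfolding norm_mult complex_mod_cnj using z1 by (intro mult_left_mono) auto
          ultimately show ?thesis by simp
        qed
        then have "(1 - norm a)\<^sup>2 \<le> (norm (1 - cnj a * z))\<^sup>2" using a by (intro power_mono) auto
        then have "(1 - (norm a)\<^sup>2) * (1 - r\<^sup>2) / (norm (1 - cnj a * z))\<^sup>2 \<le> (1 - (norm a)\<^sup>2) * (1 - r\<^sup>2) / (1 - norm a)\<^sup>2"
          using a r by (intro divide_left_mono mult_nonneg_nonneg mult_pos_pos) (auto simp: abs_square_le_1)
        then have "\<rho> r \<le> (norm (disc_aut a z))\<^sup>2"
          using one_minus_norm_disc_aut[OF a, of z] z z1 by (simp add: \<rho>_def)
        then have "\<rho> r ^ k \<le> ((norm (disc_aut a z))\<^sup>2) ^ k"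
          using elim by (intro power_mono) auto
        then have "\<rho> r ^ k * (norm (H z))\<^sup>2 \<le> ((norm (disc_aut a z))\<^sup>2) ^ k * (norm (H z))\<^sup>2"
          by (intro mult_right_mono) auto
        also have "\<dots> = (norm (disc_aut a z ^ k * H z))\<^sup>2"
          by (simp add: norm_mult norm_power power_mult_distrib power_mult[symmetric] mult.commute)
        also have "\<dots> \<le> 1" using le[OF z1] by (simp add: abs_square_le_1)
        finally have "(norm (H z))\<^sup>2 \<le> 1 / \<rho> r ^ k"
          using elim by (simp add: pos_le_divide_eq mult.commute)
        then show ?thesis by (rule real_le_rsqrt)
      qed
    qed (use r in auto)
  qed
  then have "norm (H w) \<le> sqrt (1 / 1 ^ k)"
    by (intro tendsto_le[OF trivial_limit_at_left_real lim tendsto_const])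
  then show ?thesis by simp
qed

text \<open>
  The modulus of the derivative of the automorphism at a boundary point \<open>l\<close> is
  \<open>(1 - |a|\<^sup>2) / |l - a|\<^sup>2\<close>, so this is the chain rule for dilation coefficients.
\<close>

lemma disc_aut_radial_rate:
  assumes a: "norm a < 1" and l: "norm l = 1"
    and le: "\<forall>\<^sub>F r in at_left 1. norm (g r) \<le> 1"
    and lim: "(g \<longlongrightarrow> l) (at_left (1::real))"
    and rate: "((\<lambda>r. (1 - (norm (g r))\<^sup>2) / (1 - r\<^sup>2)) \<longlongrightarrow> \<beta>) (at_left 1)"
  shows "((\<lambda>r. disc_aut a (g r)) \<longlongrightarrow> disc_aut a l) (at_left 1)"
    and "((\<lambda>r. (1 - (norm (disc_aut a (g r)))\<^sup>2) / (1 - r\<^sup>2)) \<longlongrightarrow>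
            (1 - (norm a)\<^sup>2) * \<beta> / (norm (l - a))\<^sup>2) (at_left 1)"
proof -
  have nz: "1 - cnj a * l \<noteq> 0" using one_minus_cnj_mult_neq_0[OF a] l by simp
  then show "((\<lambda>r. disc_aut a (g r)) \<longlongrightarrow> disc_aut a l) (at_left 1)"
    unfolding disc_aut_def by (intro tendsto_intros lim)
  have eq: "norm (1 - cnj a * l) = norm (l - a)"
  proof -
    have "norm (1 - cnj a * l) = norm (cnj (1 - cnj a * l))" by (simp only: complex_mod_cnj)
    also have "\<dots> = norm (1 - cnj l * a)" by (simp add: mult.commute)
    also have "\<dots> = norm (l - a)" by (rule norm_unit_diff[OF l])
    finally show ?thesis .
  qed
  have "((\<lambda>r. (1 - (norm a)\<^sup>2) * ((1 - (norm (g r))\<^sup>2) / (1 - r\<^sup>2)) / (norm (1 - cnj a * g r))\<^sup>2) \<longlongrightarrow>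
        (1 - (norm a)\<^sup>2) * \<beta> / (norm (1 - cnj a * l))\<^sup>2) (at_left 1)"
    using nz by (intro tendsto_intros rate lim) auto
  moreover have "\<forall>\<^sub>F r in at_left 1. (1 - (norm a)\<^sup>2) * ((1 - (norm (g r))\<^sup>2) / (1 - r\<^sup>2)) / (norm (1 - cnj a * g r))\<^sup>2
      = (1 - (norm (disc_aut a (g r)))\<^sup>2) / (1 - r\<^sup>2)"
    using le by eventually_elim (simp add: one_minus_norm_disc_aut[OF a])
  ultimately show "((\<lambda>r. (1 - (norm (disc_aut a (g r)))\<^sup>2) / (1 - r\<^sup>2)) \<longlongrightarrow>
            (1 - (norm a)\<^sup>2) * \<beta> / (norm (l - a))\<^sup>2) (at_left 1)"
    unfolding eq by (rule Lim_transform_eventually)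
qed

lemma power_radial_rate:
  fixes x :: "real \<Rightarrow> real"
  assumes "(x \<longlongrightarrow> 1) F" "((\<lambda>r. (1 - x r) / d r) \<longlongrightarrow> \<beta>) F"
  shows "((\<lambda>r. (1 - x r ^ k) / d r) \<longlongrightarrow> real k * \<beta>) F"
proof -
  have "((\<lambda>r. (1 - x r) / d r * (\<Sum>i<k. x r ^ i)) \<longlongrightarrow> \<beta> * (\<Sum>i<k. 1 ^ i)) F"
    by (intro tendsto_intros assms)
  then show ?thesis by (simp add: one_diff_power_eq mult.commute)
qed

text \<open>
  From \<open>f z - z0 = (z - z0) ^ k * h z\<close> the quotient of \<open>T \<circ> f\<close> by \<open>T ^ k\<close> is read off without a
  singularity; its value at \<open>z0\<close> is \<open>h z0\<close> times \<open>k\<close> factors \<open>1 - |z0|\<^sup>2\<close> from \<open>T ^ k\<close>, one of which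
  is cancelled by the denominator of \<open>T (f z0)\<close>.
\<close>

lemma blaschke_quotient:
  assumes holo: "f holomorphic_on ball 0 1" and maps: "f ` ball 0 1 \<subseteq> ball 0 1"
    and k: "k \<ge> 1" and z0: "norm z0 < 1" and fp: "f z0 = z0"
    and van: "\<And>i. i \<in> {1..k - 1} \<Longrightarrow> (deriv ^^ i) f z0 = 0"
  obtains H where "H holomorphic_on ball 0 1"
    "\<And>z. norm z < 1 \<Longrightarrow> disc_aut z0 (f z) = disc_aut z0 z ^ k * H z"
    "H z0 = (deriv ^^ k) f z0 / fact k * of_real ((1 - (norm z0)\<^sup>2) ^ (k - 1))"
proof -
  let ?B = "ball (0 :: complex) 1"
  have lt: "norm (f z) < 1" if "norm z < 1" for z
    using self_map_norm_less[OF maps that] .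
  have diff: "(deriv ^^ i) (\<lambda>z. f z - z0) z0 = (if i = 0 then 0 else (deriv ^^ i) f z0)" for i
    using higher_deriv_diff[OF holo holomorphic_on_const open_ball, of z0 i z0] z0 fp by simp
  have "(deriv ^^ i) (\<lambda>z. f z - z0) z0 = 0" if "i < k" for i
    using van[of i] that by (cases "i = 0") (auto simp: diff fp)
  moreover have "(\<lambda>z. f z - z0) holomorphic_on ?B" by (intro holomorphic_intros holo)
  ultimately obtain h where h: "h holomorphic_on ?B" "\<forall>z\<in>?B. f z - z0 = (z - z0) ^ k * h z"
    "h z0 = (deriv ^^ k) (\<lambda>z. f z - z0) z0 / fact k"
    using holomorphic_factor_power[of "\<lambda>z. f z - z0" ?B z0 k] z0 by auto
  define H where "H = (\<lambda>z. (1 - cnj z0 * z) ^ k * h z / (1 - cnj z0 * f z))"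
  have nz: "1 - cnj z0 * z \<noteq> 0" "1 - cnj z0 * f z \<noteq> 0" if "norm z < 1" for z
    using one_minus_cnj_mult_neq_0[OF z0] lt[OF that] that by (simp_all add: less_imp_le)
  show ?thesis
  proof (rule that[of H])
    show "H holomorphic_on ?B"
      unfolding H_def using nz by (intro holomorphic_intros h holo) auto
    show "disc_aut z0 (f z) = disc_aut z0 z ^ k * H z" if "norm z < 1" for z
      using h(2) that nz[OF that] by (simp add: disc_aut_def H_def power_divide)
    have 1: "1 - cnj z0 * z0 = of_real (1 - (norm z0)\<^sup>2)"
      by (simp only: of_real_diff of_real_1 complex_norm_square mult.commute)
    have 2: "1 - (norm z0)\<^sup>2 \<noteq> 0" using z0 by (simp add: abs_square_less_1 less_imp_neq)
    have "H z0 = of_real (1 - (norm z0)\<^sup>2) ^ k * h z0 / of_real (1 - (norm z0)\<^sup>2)"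
      by (simp only: H_def fp 1)
    also have "\<dots> = of_real (1 - (norm z0)\<^sup>2) ^ (k - 1) * h z0"
      using k 2 by (cases k) (simp_all del: of_real_diff of_real_power)
    also have "h z0 = (deriv ^^ k) f z0 / fact k" using k by (simp add: h(3) diff)
    finally show "H z0 = (deriv ^^ k) f z0 / fact k * of_real ((1 - (norm z0)\<^sup>2) ^ (k - 1))"
      by (simp only: of_real_power mult.commute)
  qed
qed

text \<open>
  Dilation coefficients are additive under products of functions with unimodular boundary values,
  so that of \<open>H\<close> is that of \<open>T \<circ> f\<close> minus \<open>k\<close> times that of \<open>T\<close>.
\<close>

lemma blaschke_quotient_radial_rate:
  assumes holo: "f holomorphic_on ball 0 1" and maps: "f ` ball 0 1 \<subseteq> ball 0 1" and a: "norm a < 1"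
    and H: "\<And>z. norm z < 1 \<Longrightarrow> disc_aut a (f z) = disc_aut a z ^ k * H z"
    and \<sigma>: "norm \<sigma> = 1" and fin: "boundary_dilation f \<sigma> < \<infinity>"
    and bv: "disc_aut a (boundary_value f \<sigma>) = disc_aut a \<sigma> ^ k"
  shows "((\<lambda>r. H (of_real r * \<sigma>)) \<longlongrightarrow> 1) (at_left 1)"
    and "((\<lambda>r. (1 - (norm (H (of_real r * \<sigma>)))\<^sup>2) / (1 - r\<^sup>2)) \<longlongrightarrow>
       (1 - (norm a)\<^sup>2) * real_of_ereal (boundary_dilation f \<sigma>) / (norm (boundary_value f \<sigma> - a))\<^sup>2
       - real k * ((1 - (norm a)\<^sup>2) / (norm (\<sigma> - a))\<^sup>2)) (at_left 1)"
proof -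
  let ?z = "\<lambda>r. of_real r * \<sigma>"
  let ?T = "\<lambda>r. disc_aut a (?z r)"
  let ?G = "\<lambda>r. disc_aut a (f (?z r))"
  let ?R = "(1 - (norm a)\<^sup>2) * real_of_ereal (boundary_dilation f \<sigma>) / (norm (boundary_value f \<sigma> - a))\<^sup>2"
  let ?Q = "(1 - (norm a)\<^sup>2) / (norm (\<sigma> - a))\<^sup>2"
  note bd = boundary_dilation_radial[OF holo maps \<sigma> fin]
  have ev: "\<forall>\<^sub>F r in at_left 1. norm (?z r) < 1" by (rule eventually_radial_in_disc[OF \<sigma>])
  have ev_f: "\<forall>\<^sub>F r in at_left 1. norm (f (?z r)) \<le> 1"
    using ev by eventually_elim (simp add: less_imp_le self_map_norm_less[OF maps])
  have G: "(?G \<longlongrightarrow> disc_aut a (boundary_value f \<sigma>)) (at_left 1)"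
    "((\<lambda>r. (1 - (norm (?G r))\<^sup>2) / (1 - r\<^sup>2)) \<longlongrightarrow> ?R) (at_left 1)"
    by (rule disc_aut_radial_rate[OF a bd(1) ev_f bd(2,3)])+
  have id_rate: "((\<lambda>r. (1 - (norm (?z r))\<^sup>2) / (1 - r\<^sup>2)) \<longlongrightarrow> 1) (at_left 1)"
  proof (rule Lim_transform_eventually[OF tendsto_const])
    show "\<forall>\<^sub>F r in at_left 1. 1 = (1 - (norm (?z r))\<^sup>2) / (1 - r\<^sup>2)"
      using eventually_radial
    proof eventually_elim
      case (elim r)
      then have "r\<^sup>2 < 1" by (simp add: abs_square_less_1)
      then show ?case using \<sigma> by (simp add: norm_mult)
    qed
  qed
  have ev_z: "\<forall>\<^sub>F r in at_left 1. norm (?z r) \<le> 1"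
    using ev by eventually_elim simp
  have T: "(?T \<longlongrightarrow> disc_aut a \<sigma>) (at_left 1)"
    "((\<lambda>r. (1 - (norm (?T r))\<^sup>2) / (1 - r\<^sup>2)) \<longlongrightarrow> ?Q) (at_left 1)"
    using disc_aut_radial_rate[OF a \<sigma> ev_z radial_tendsto id_rate] by simp_all
  have T1: "norm (disc_aut a \<sigma>) = 1" by (rule norm_disc_aut_eq_1[OF a \<sigma>])
  then have T0: "disc_aut a \<sigma> \<noteq> 0" by auto
  have ev_T: "\<forall>\<^sub>F r in at_left 1. ?T r \<noteq> 0"
    using T(1) T0 by (rule tendsto_imp_eventually_ne)
  have ev_H: "\<forall>\<^sub>F r in at_left 1. ?G r / ?T r ^ k = H (?z r)"
    using ev ev_T by eventually_elim (simp add: H)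
  have "((\<lambda>r. ?G r / ?T r ^ k) \<longlongrightarrow> disc_aut a (boundary_value f \<sigma>) / disc_aut a \<sigma> ^ k) (at_left 1)"
    using T0 by (intro tendsto_divide tendsto_power G(1) T(1)) auto
  then have "((\<lambda>r. ?G r / ?T r ^ k) \<longlongrightarrow> 1) (at_left 1)" using T0 by (simp add: bv)
  then show "((\<lambda>r. H (?z r)) \<longlongrightarrow> 1) (at_left 1)"
    using ev_H by (rule Lim_transform_eventually)
  have norm_T: "((\<lambda>r. (norm (?T r))\<^sup>2) \<longlongrightarrow> 1) (at_left 1)"
    using tendsto_power[OF tendsto_norm[OF T(1)], of 2] T1 by simp
  have "((\<lambda>r. ((1 - (norm (?G r))\<^sup>2) / (1 - r\<^sup>2) - (1 - ((norm (?T r))\<^sup>2) ^ k) / (1 - r\<^sup>2)) / ((norm (?T r))\<^sup>2) ^ k)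
     \<longlongrightarrow> (?R - real k * ?Q) / 1 ^ k) (at_left 1)"
    by (intro tendsto_divide tendsto_diff tendsto_power G(2) power_radial_rate norm_T T(2)) simp
  then have "((\<lambda>r. ((1 - (norm (?G r))\<^sup>2) / (1 - r\<^sup>2) - (1 - ((norm (?T r))\<^sup>2) ^ k) / (1 - r\<^sup>2)) / ((norm (?T r))\<^sup>2) ^ k)
     \<longlongrightarrow> ?R - real k * ?Q) (at_left 1)" by simp
  moreover have "\<forall>\<^sub>F r in at_left 1. ((1 - (norm (?G r))\<^sup>2) / (1 - r\<^sup>2) - (1 - ((norm (?T r))\<^sup>2) ^ k) / (1 - r\<^sup>2)) / ((norm (?T r))\<^sup>2) ^ k
     = (1 - (norm (H (?z r)))\<^sup>2) / (1 - r\<^sup>2)"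
    using ev_H ev_T
  proof eventually_elim
    case (elim r)
    have "(norm (H (?z r)))\<^sup>2 = (norm (?G r))\<^sup>2 / ((norm (?T r))\<^sup>2) ^ k"
      unfolding elim(1)[symmetric]
      by (simp add: norm_divide norm_power power_divide power_mult[symmetric] mult.commute)
    moreover have "(1 - G / T) / d = ((1 - G) / d - (1 - T) / d) / T" if "T \<noteq> 0" for G T d :: real
      using that by (cases "d = 0") (simp_all add: field_simps)
    ultimately show ?case using elim(2) by simp
  qed
  ultimately show "((\<lambda>r. (1 - (norm (H (?z r)))\<^sup>2) / (1 - r\<^sup>2)) \<longlongrightarrow> ?R - real k * ?Q) (at_left 1)"
    by (rule Lim_transform_eventually)
qed

text \<open>
  For a unimodular \<open>u\<close> one has \<open>|u - a|\<^sup>2 = 1 + |a|\<^sup>2 - 2 Re (u cnj a)\<close>, so the factor of the dilation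
  coefficient in the theorem is a quotient of squared distances.
\<close>

lemma distance_ratio:
  assumes "norm l = 1" "norm \<sigma> = 1" "l \<noteq> a"
  shows "1 + 2 * Re ((l - \<sigma>) * cnj a / of_real ((norm (l - a))\<^sup>2)) = (norm (\<sigma> - a))\<^sup>2 / (norm (l - a))\<^sup>2"
proof -
  have d: "(norm (u - a))\<^sup>2 = 1 + (norm a)\<^sup>2 - 2 * Re (u * cnj a)" if "norm u = 1" for u
  proof -
    have "(Re u)\<^sup>2 + (Im u)\<^sup>2 = 1" using that by (metis cmod_power2 one_power2)
    then show ?thesis unfolding cmod_power2 by (simp add: power2_eq_square algebra_simps)
  qed
  have "(norm (\<sigma> - a))\<^sup>2 = (norm (l - a))\<^sup>2 + 2 * Re ((l - \<sigma>) * cnj a)"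
    unfolding d[OF assms(1)] d[OF assms(2)] by (simp add: algebra_simps)
  moreover have "(norm (l - a))\<^sup>2 \<noteq> 0" using assms(3) by simp
  ultimately show ?thesis by (simp only: Re_divide_of_real add_divide_distrib divide_self) simp
qed

section \<open>The boundary dilation inequality\<close>

theorem theorem1p9:
  fixes f :: "complex \<Rightarrow> complex" and z0 :: complex and \<sigma> :: "nat \<Rightarrow> complex" and k n :: nat
  assumes "f holomorphic_on ball 0 1"
    and "f ` ball 0 1 \<subseteq> ball 0 1"
    and "k \<ge> 1" and "n \<ge> 1"
    and "\<not> (\<exists>d\<le>k. blaschke_product d f)"
    and "z0 \<in> ball 0 1"
    and "f z0 = z0"
    and "\<And>i. i \<in> {1..k - 1} \<Longrightarrow> (deriv ^^ i) f z0 = 0"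
    and "\<And>j. j \<in> {1..n} \<Longrightarrow> norm (\<sigma> j) = 1"
    and "inj_on \<sigma> {1..n}"
    and "\<And>j. j \<in> {1..n} \<Longrightarrow> boundary_dilation f (\<sigma> j) < \<infinity>"
    and "\<And>j. j \<in> {1..n} \<Longrightarrow>
           boundary_value f (\<sigma> j) =
             (((\<sigma> j - z0) / (1 - cnj z0 * \<sigma> j)) ^ k + z0) /
             (1 + cnj z0 * ((\<sigma> j - z0) / (1 - cnj z0 * \<sigma> j)) ^ k)"
  shows "let c = (deriv ^^ k) f z0 / fact k * of_real ((1 - (norm z0)\<^sup>2) ^ (k - 1));
             lhs = (\<Sum>j=1..n. 1 /
               ((1 + 2 * Re ((boundary_value f (\<sigma> j) - \<sigma> j) * cnj z0 /
                             of_real ((norm (boundary_value f (\<sigma> j) - z0))\<^sup>2)))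
                  * real_of_ereal (boundary_dilation f (\<sigma> j)) - real k));
             rhs = (1 - (norm c)\<^sup>2) / (norm (1 - c))\<^sup>2
         in lhs \<le> rhs \<and> (lhs = rhs \<longleftrightarrow> blaschke_product (n + k) f)"
proof -
  note holo = assms(1) and maps = assms(2) and \<sigma> = assms(9) and inj = assms(10)
  have z0: "norm z0 < 1" using assms(6) by simp
  define c where "c = (deriv ^^ k) f z0 / fact k * of_real ((1 - (norm z0)\<^sup>2) ^ (k - 1))"
  have lt: "norm (f z) < 1" if "norm z < 1" for z
    using self_map_norm_less[OF maps that] .
  obtain H where H: "H holomorphic_on ball 0 1"
    and GH: "\<And>z. norm z < 1 \<Longrightarrow> disc_aut z0 (f z) = disc_aut z0 z ^ k * H z"
    and Hz0: "H z0 = c"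
    using blaschke_quotient[OF holo maps assms(3) z0 assms(7,8), folded c_def] by blast
  have bl_iff: "blaschke_product (d + k) f \<longleftrightarrow> blaschke_product d H" for d
  proof -
    have "blaschke_product (d + k) f \<longleftrightarrow> blaschke_product (d + k) (\<lambda>z. disc_aut z0 (f z))"
      by (rule blaschke_product_disc_aut_iff[OF z0 maps, symmetric])
    also have "\<dots> \<longleftrightarrow> blaschke_product (d + k) (\<lambda>z. disc_aut z0 z ^ k * H z)"
      by (rule blaschke_product_cong[OF GH])
    also have "\<dots> \<longleftrightarrow> blaschke_product d H"
      by (rule blaschke_product_times_disc_aut_power[OF z0 H])
    finally show ?thesis .
  qed
  have H_le: "norm (H z) \<le> 1" if "norm z < 1" for z
  proof (rule norm_le_1_of_disc_aut_power[OF z0 H _ that])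
    show "norm (disc_aut z0 w ^ k * H w) \<le> 1" if "norm w < 1" for w
      using norm_disc_aut_less_1[OF z0 lt[OF that]] by (simp only: GH[OF that, symmetric])
  qed
  \<comment> \<open>This is where the assumption on Blaschke products of degree at most \<open>k\<close> enters.\<close>
  have H_lt: "norm (H z) < 1" if z: "norm z < 1" for z
  proof (rule ccontr)
    assume "\<not> norm (H z) < 1"
    then have Hz: "norm (H z) = 1" using H_le[OF z] by simp
    have "H constant_on ball 0 1"
      using H_le Hz z
      by (intro maximum_modulus_principle[where S = "ball 0 1" and U = "ball 0 1" and \<xi> = z, OF H]) auto
    then have "\<And>w. norm w < 1 \<Longrightarrow> H w = H z" using z by (force simp: constant_on_def)
    then have "blaschke_product 0 H \<longleftrightarrow> blaschke_product 0 (\<lambda>_. H z)" by (rule blaschke_product_cong)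
    then have "blaschke_product 0 H" using blaschke_product_const[OF Hz] by blast
    then have "blaschke_product k f" using bl_iff[of 0] by simp
    then show False using assms(5) by blast
  qed
  have H_maps: "H ` ball 0 1 \<subseteq> ball 0 1" using H_lt by auto
  define b where "b j = (1 - (norm z0)\<^sup>2) * real_of_ereal (boundary_dilation f (\<sigma> j)) / (norm (boundary_value f (\<sigma> j) - z0))\<^sup>2
       - real k * ((1 - (norm z0)\<^sup>2) / (norm (\<sigma> j - z0))\<^sup>2)" for j
  have bv: "disc_aut z0 (boundary_value f (\<sigma> j)) = disc_aut z0 (\<sigma> j) ^ k" if j: "j \<in> {1..n}" for j
  proof -
    have "boundary_value f (\<sigma> j) = disc_aut (- z0) (disc_aut z0 (\<sigma> j) ^ k)"
      unfolding assms(12)[OF j] by (simp add: disc_aut_def)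
    moreover have "norm (disc_aut z0 (\<sigma> j) ^ k) \<le> 1"
      by (simp add: norm_power norm_disc_aut_eq_1[OF z0 \<sigma>[OF j]])
    ultimately show ?thesis
      using disc_aut_inverse[of "- z0" "disc_aut z0 (\<sigma> j) ^ k"] z0 by simp
  qed
  note rate = blaschke_quotient_radial_rate[OF holo maps z0 GH \<sigma> assms(11) bv]
  have summand: "1 / ((1 + 2 * Re ((boundary_value f (\<sigma> j) - \<sigma> j) * cnj z0 /
                             of_real ((norm (boundary_value f (\<sigma> j) - z0))\<^sup>2)))
                  * real_of_ereal (boundary_dilation f (\<sigma> j)) - real k)
      = 1 / b j * Re (herglotz (\<sigma> j) z0)" if j: "j \<in> {1..n}" for j
  proof -
    let ?l = "boundary_value f (\<sigma> j)"
    have l: "norm ?l = 1" by (rule boundary_dilation_radial(1)[OF holo maps \<sigma>[OF j] assms(11)[OF j]])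
    have ne: "?l \<noteq> z0" "\<sigma> j \<noteq> z0" using l \<sigma>[OF j] z0 by auto
    have id: "1 / (s / u * \<beta> - x) = 1 / (A * \<beta> / u - x * (A / s)) * (A / s)"
      if "s \<noteq> 0" "A \<noteq> 0" for s u \<beta> x A :: real
    proof -
      have "A * \<beta> / u - x * (A / s) = (A / s) * (s / u * \<beta> - x)"
        using that by (simp add: algebra_simps)
      then show ?thesis using that by simp
    qed
    have sq: "(norm z0)\<^sup>2 < 1" using z0 by (simp add: abs_square_less_1)
    show ?thesis
      unfolding distance_ratio[OF l \<sigma>[OF j] ne(1)] b_def Re_herglotz[OF \<sigma>[OF j]]
      by (rule id) (use ne sq in auto)
  qed
  have sum: "(\<Sum>j=1..n. 1 / ((1 + 2 * Re ((boundary_value f (\<sigma> j) - \<sigma> j) * cnj z0 /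
                             of_real ((norm (boundary_value f (\<sigma> j) - z0))\<^sup>2)))
                  * real_of_ereal (boundary_dilation f (\<sigma> j)) - real k))
      = (\<Sum>j=1..n. 1 / b j * Re (herglotz (\<sigma> j) z0))"
    by (intro sum.cong summand refl)
  have rhs: "(1 - (norm c)\<^sup>2) / (norm (1 - c))\<^sup>2 = Re (cayley (H z0))"
    by (simp add: Re_cayley Hz0)
  have card: "card {1..n} = n" by simp
  note cp = cowen_pommerenke[OF H H_maps finite_atLeastAtMost inj \<sigma> rate[folded b_def] z0, unfolded card]
  show ?thesis
    unfolding Let_def c_def[symmetric] sum rhs bl_iff
    using cp by blast
qed

end
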